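(* For any parity constraints over input variables $X=\{x_1,\dots,x_n\}$ with linear encodings $a=\mathsf{Parity}(A,S,\sigma_a)$ and $b=\mathsf{Parity}(B,T,\sigma_b)$ (any $A,B\subseteq X$ and any orderings $\sigma_a,\sigma_b$ for which the formula below is defined), the formula $\mathsf{rAddPar}(a,b)$ has a DRAT$^-$ refutation with $O(n\log n)$ lines.
   Context: For literals $y_1,\dots,y_k$, $\mathsf{xor}(y_1,\dots,y_k)$ is the CNF of all $2^{k-1}$ clauses on exactly these literals with an odd (if $k$ odd) or even (if $k$ even) number of unnegated $y_j$'s; it encodes $y_1\oplus\dots\oplus y_k=0$. For a list of $m\ge4$ literals $(y_1,\dots,y_m)$ with fresh variables $t_1,\dots,t_{m-3}$, its linear encoding is $\mathsf{xor}(y_1,y_2,t_1)\wedge\bigwedge_{j=1}^{m-4}\mathsf{xor}(t_j,y_{j+2},t_{j+1})\wedge\mathsf{xor}(t_{m-3},y_{m-1},y_m)$. $a=\mathsf{Parity}(A,S,\sigma_a)$ is the linear encoding of $A$ listed in order $\sigma_a$ with Tseitin variables $S$; $b$ likewise for $B,\sigma_b,T$. $C$ is $A\triangle B$ with one literal negated, listed in increasing index order, and $\mathsf{rAddPar}(a,b)=a\wedge b\wedge\mathsf{Parity}(C,U,\mathrm{id})$ with $S,T,U,X$ pairwise disjoint. DRAT: for a CNF $F$, $F\vdash_1\bot$ means unit propagation on $F$ derives the empty clause. A clause $C$ is an asymmetric tautology (AT) w.r.t. $F$ if $F\wedge\bar C\vdash_1\bot$ (where $\bar C$ is the conjunction of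 the negations of its literals), and a resolution asymmetric tautology (RAT) w.r.t. $F$ if there is a literal $l\in C$ such that for every clause $\bar l\vee D\in F$, $F\wedge\bar D\wedge\bar C\vdash_1\bot$. A DRAT proof is a sequence of steps each adding to the current formula $F$ a clause that is AT or RAT w.r.t. $F$, or deleting from $F\wedge C$ a clause $C$ that is AT or RAT w.r.t. $F$; a refutation ends with the empty clause. DRAT$^-$ is DRAT in which no variables outside the original formula may be introduced. Lines are the steps of the proof. *)

theory Defs
  imports
    "HOL-Library.Landau_Symbols"
    "HOL-Combinatorics.Multiset_Permutations"
begin

datatype 'v lit = Pos (var: 'v) | Neg (var: 'v)

fun neg :: "'v lit \<Rightarrow> 'v lit" where
  "neg (Pos v) = Neg v"
| "neg (Neg v) = Pos v"

type_synonym 'v clause = "'v lit set"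
type_synonym 'v cnf = "'v clause set"

definition vars :: "'v cnf \<Rightarrow> 'v set" where
  "vars F = var ` \<Union>F"

text \<open>
  The set \<open>N\<close> is the set of positions that get negated.  The corresponding clause excludes exactly
  the assignment making the literals at the positions in \<open>N\<close> true and the others false, so
  excluding an odd number of true literals means that \<open>N\<close> has odd size.  (In terms of unnegated
  literals: an even number of them for odd length, an odd number for even length.)
\<close>
definition xor_cnf :: "'v lit list \<Rightarrow> 'v cnf" where
  "xor_cnf ys =
     {(\<lambda>i. if i \<in> N then neg (ys ! i) else ys ! i) ` {..<length ys} | N.
        N \<subseteq> {..<length ys} \<and> odd (card N)}"

fun lit_true :: "('v \<Rightarrow> bool) \<Rightarrow> 'v lit \<Rightarrow> bool" where
  "lit_true I (Pos v) \<longleftrightarrow> I v"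
| "lit_true I (Neg v) \<longleftrightarrow> \<not> I v"

lemma lit_true_neg [simp]: "lit_true I (neg l) \<longleftrightarrow> \<not> lit_true I l"
  by (cases l) auto

lemma xor_cnf_encodes_parity:
  "(\<forall>C\<in>xor_cnf ys. \<exists>l\<in>C. lit_true I l) \<longleftrightarrow> even (card {i. i < length ys \<and> lit_true I (ys ! i)})"
proof -
  define M where "M = {i. i < length ys \<and> lit_true I (ys ! i)}"
  have M: "M \<subseteq> {..<length ys}"
    by (auto simp: M_def)
  have "(\<exists>l\<in>(\<lambda>i. if i \<in> N then neg (ys ! i) else ys ! i) ` {..<length ys}. lit_true I l) \<longleftrightarrow> N \<noteq> M"
    if "N \<subseteq> {..<length ys}" for N
  proof -
    have "(\<exists>i<length ys. lit_true I (if i \<in> N then neg (ys ! i) else ys ! i)) \<longleftrightarrow>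
        (\<exists>i<length ys. i \<in> N \<longleftrightarrow> i \<notin> M)"
      by (auto simp: M_def)
    also have "\<dots> \<longleftrightarrow> N \<noteq> M"
      using that M by blast
    finally show ?thesis
      by (simp only: bex_simps image_iff Bex_def lessThan_iff) blast
  qed
  then have "(\<forall>C\<in>xor_cnf ys. \<exists>l\<in>C. lit_true I l) \<longleftrightarrow>
      (\<forall>N. N \<subseteq> {..<length ys} \<and> odd (card N) \<longrightarrow> N \<noteq> M)"
    unfolding xor_cnf_def by blast
  also have "\<dots> \<longleftrightarrow> even (card M)"
    using M by blast
  finally show ?thesis
    unfolding M_def .
qed

text \<open>
  With \<open>m = length ys\<close>, this is meant for \<open>m \<ge> 4\<close>, \<open>length ts = m - 3\<close> and \<open>ts\<close> distinct and fresh.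
  Lists are indexed from \<open>0\<close>.
\<close>
definition linear_encoding :: "'v lit list \<Rightarrow> 'v list \<Rightarrow> 'v cnf" where
  "linear_encoding ys ts =
     (let m = length ys in
        xor_cnf [ys ! 0, ys ! 1, Pos (ts ! 0)]
        \<union> (\<Union>j<m - 4. xor_cnf [Pos (ts ! j), ys ! (j + 2), Pos (ts ! (j + 1))])
        \<union> xor_cnf [Pos (ts ! (m - 4)), ys ! (m - 2), ys ! (m - 1)])"

text \<open>
  An ordering of a finite set \<open>A\<close> of variables is a list in \<^term>\<open>permutations_of_set A\<close>; the set
  is recoverable from the list.
\<close>
definition Parity :: "'v list \<Rightarrow> 'v list \<Rightarrow> 'v cnf" where
  "Parity \<sigma> ts = linear_encoding (map Pos \<sigma>) ts"

definition sum_constraint :: "'v list \<Rightarrow> 'v set \<Rightarrow> 'v set \<Rightarrow> 'v \<Rightarrow> 'v lit list" where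
  "sum_constraint xs A B z =
     map (\<lambda>v. if v = z then Neg v else Pos v) (filter (\<lambda>v. v \<in> sym_diff A B) xs)"

text \<open>
  \<open>xs\<close> lists the input variables in increasing index order, \<open>z\<close> is the variable of the symmetric
  difference whose literal is negated.
\<close>
definition rAddPar ::
  "'v list \<Rightarrow> 'v list \<Rightarrow> 'v list \<Rightarrow> 'v list \<Rightarrow> 'v list \<Rightarrow> 'v \<Rightarrow> 'v list \<Rightarrow> 'v cnf" where
  "rAddPar xs \<sigma>a S \<sigma>b T z U =
     Parity \<sigma>a S \<union> Parity \<sigma>b T \<union> linear_encoding (sum_constraint xs (set \<sigma>a) (set \<sigma>b) z) U"

text \<open>Unit propagation as closure under resolution with unit clauses.\<close>
inductive up_derives :: "'v cnf \<Rightarrow> 'v clause \<Rightarrow> bool" for F where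
  up_axiom: "C \<in> F \<Longrightarrow> up_derives F C"
| up_resolve: "up_derives F C \<Longrightarrow> up_derives F {l} \<Longrightarrow> neg l \<in> C \<Longrightarrow> up_derives F (C - {neg l})"

abbreviation up_refutes :: "'v cnf \<Rightarrow> bool" where
  "up_refutes F \<equiv> up_derives F {}"

definition negated_units :: "'v clause \<Rightarrow> 'v cnf" where
  "negated_units C = {{neg l} | l. l \<in> C}"

definition AT :: "'v cnf \<Rightarrow> 'v clause \<Rightarrow> bool" where
  "AT F C \<longleftrightarrow> up_refutes (F \<union> negated_units C)"

definition RAT :: "'v cnf \<Rightarrow> 'v clause \<Rightarrow> bool" where
  "RAT F C \<longleftrightarrow>
     (\<exists>l\<in>C. \<forall>D. insert (neg l) D \<in> F \<longrightarrow> up_refutes (F \<union> negated_units D \<union> negated_units C))"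

datatype 'v step = Add "'v clause" | Del "'v clause"

fun drat_proof :: "'v cnf \<Rightarrow> 'v step list \<Rightarrow> bool" where
  "drat_proof F [] \<longleftrightarrow> True"
| "drat_proof F (Add C # \<pi>) \<longleftrightarrow>
     finite C \<and> (AT F C \<or> RAT F C) \<and> drat_proof (insert C F) \<pi>"
| "drat_proof F (Del C # \<pi>) \<longleftrightarrow>
     C \<in> F \<and> (AT (F - {C}) C \<or> RAT (F - {C}) C) \<and> drat_proof (F - {C}) \<pi>"

definition drat_refutation :: "'v cnf \<Rightarrow> 'v step list \<Rightarrow> bool" where
  "drat_refutation F \<pi> \<longleftrightarrow> drat_proof F \<pi> \<and> \<pi> \<noteq> [] \<and> last \<pi> = Add {}"

definition drat_minus_refutation :: "'v cnf \<Rightarrow> 'v step list \<Rightarrow> bool" where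
  "drat_minus_refutation F \<pi> \<longleftrightarrow>
     drat_refutation F \<pi> \<and> (\<forall>C. Add C \<in> set \<pi> \<longrightarrow> var ` C \<subseteq> vars F)"

end

theory Submission
  imports Defs
begin

text \<open>
  Every variable of the formula occurs in exactly two xor constraints, each on three variables:
  it is a Tseitin formula of odd total charge on a cubic graph with \<open>O(n)\<close> vertices, the
  constraints (gates) being vertices and the variables edges.  Given two gates
  \<open>a + b + t = c\<^sub>1\<close> and \<open>t + e + f = c\<^sub>2\<close> one can derive their sum, delete both by RAT on \<open>t\<close>, and then
  either forget \<open>t\<close> (contraction of an edge) or reintroduce it by RAT as the variable of
  \<open>a + e + t = c\<^sub>1\<close> and \<open>t + b + f = c\<^sub>2\<close> (exchange).  An exchange shortens a cycle by one, and two gates sharing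
  two variables can be contracted without increasing the arity.  Since a cubic graph with \<open>N\<close> vertices has
  a cycle of length \<open>O(log N)\<close>, a vertex can be removed with \<open>O(log N)\<close> lines; as the total charge stays
  odd, the constraint \<open>0 = 1\<close> must eventually appear.
\<close>

subsection \<open>Unit propagation and DRAT derivations\<close>

text \<open>The obstacle is arity. Two ternary gates with a single common variable have a sum on
  four variables, and eliminating variables in an arbitrary order can make the sums wide. As long as
  all gates have at most three variables, every local change involves at most five variables and so
  costs a constant number of lines. The resource is the shared variable: once all clauses containing
  \<open>t\<close> are deleted, \<open>t\<close> is as good as fresh, so its name can be reused with
  a new meaning and the variable restriction of DRAT- is respected. This is why deletions are part
  of every change and why two occurrences per variable are kept as an invariant. The orderings of
  the inputs have no influence, since only the occurrence counts and the total charge enter the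
  argument. The logarithm is the classical girth bound for graphs of minimum degree three.\<close>

lemma neg_neg [simp]: "neg (neg l) = l"
  by (cases l) auto

lemma var_neg [simp]: "var (neg l) = var l"
  by (cases l) auto

lemma neg_eq_iff [simp]: "neg l = neg l' \<longleftrightarrow> l = l'"
  by (metis neg_neg)

lemma up_derives_mono: "up_derives F C \<Longrightarrow> F \<subseteq> G \<Longrightarrow> up_derives G C"
proof (induction rule: up_derives.induct)
  case (up_axiom C)
  then show ?case using up_derives.up_axiom[of C G] by auto
next
  case (up_resolve C l)
  show ?case by (rule up_derives.up_resolve) (fact up_resolve.IH(1)[OF up_resolve.prems] up_resolve.IH(2)[OF up_resolve.prems] up_resolve.hyps)+
qed

text \<open>The literals of \<open>C\<close> are removed one propagation at a time, hence the
  finiteness. With this, AT and RAT reduce to looking at what clauses retain outside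
  \<open>C\<close>.\<close>

lemma up_strip:
  assumes "finite C" "up_derives F D" "\<And>l. l \<in> C \<Longrightarrow> up_derives F {neg l}"
  shows "up_derives F (D - C)"
  using assms
proof (induction C rule: finite_induct)
  case (insert x C)
  then have D: "up_derives F (D - C)" by simp
  show ?case
  proof (cases "x \<in> D")
    case True
    have "up_derives F ((D - C) - {neg (neg x)})"
      by (rule up_resolve[OF D]) (use insert.prems(2)[of x] insert.hyps(2) True in simp_all)
    then show ?thesis by (metis Diff_insert neg_neg)
  next
    case False
    with D show ?thesis by simp
  qed
qed simp

lemma AT_mono: "AT F C \<Longrightarrow> F \<subseteq> G \<Longrightarrow> AT G C"
  unfolding AT_def by (erule up_derives_mono) auto

lemma AT_subsumed:
  assumes "D \<in> F" "D \<subseteq> C" "finite C"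
  shows "AT F C"
proof -
  have "up_derives (F \<union> negated_units C) (D - C)"
    using assms by (intro up_strip) (auto intro!: up_axiom simp: negated_units_def)
  moreover have "D - C = {}" using assms by auto
  ultimately show ?thesis unfolding AT_def by simp
qed

text \<open>The negated units of \<open>C\<close> strip \<open>D1\<close> and \<open>D2\<close> to
  at most \<open>{l}\<close> and \<open>{neg l}\<close>; either one of them is already empty or the
  two units clash.\<close>

lemma AT_resolvent:
  assumes D1: "D1 \<in> F" "D1 \<subseteq> insert l C" and D2: "D2 \<in> F" "D2 \<subseteq> insert (neg l) C"
    and "finite C"
  shows "AT F C"
proof -
  let ?G = "F \<union> negated_units C"
  have units: "up_derives ?G {neg k}" if "k \<in> C" for k
    using that by (auto intro!: up_axiom simp: negated_units_def)
  show ?thesis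
  proof (cases "D1 \<subseteq> C \<or> D2 \<subseteq> C")
    case True
    then show ?thesis using assms AT_subsumed by metis
  next
    case False
    have "up_derives ?G (D1 - C)" "up_derives ?G (D2 - C)"
      using assms units by (auto intro!: up_strip intro: up_axiom)
    moreover have "D1 - C = {l}" "D2 - C = {neg l}" using False D1 D2 by auto
    ultimately have "up_derives ?G ({neg l} - {neg l})"
      by (intro up_resolve) auto
    then show ?thesis unfolding AT_def by simp
  qed
qed

text \<open>A resolvent on \<open>l\<close> is harmless if it is tautological or contains a clause
  of \<open>F\<close>. The hypothesis speaks of the whole clause \<open>D\<close>, whereas the
  remainder quantified over in \<open>RAT\<close> may or may not contain \<open>neg l\<close>
  itself.\<close>

lemma RAT_resolvents:
  assumes l: "l \<in> C" and fin: "finite C" "\<And>D. D \<in> F \<Longrightarrow> finite D"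
    and res: "\<And>D. D \<in> F \<Longrightarrow> neg l \<in> D \<Longrightarrow>
      (\<exists>x\<in>C. x \<noteq> l \<and> neg x \<in> D) \<or> (\<exists>E\<in>F. E \<subseteq> (C - {l}) \<union> (D - {neg l}))"
  shows "RAT F C"
  unfolding RAT_def
proof (intro bexI[OF _ l] allI impI)
  fix D assume D: "insert (neg l) D \<in> F"
  let ?G = "F \<union> negated_units D \<union> negated_units C"
  have units: "up_derives ?G {neg k}" if "k \<in> C \<union> D" for k
    using that by (auto intro!: up_axiom simp: negated_units_def)
  from res[OF D] consider x where "x \<in> C" "x \<noteq> l" "neg x \<in> D"
    | E where "E \<in> F" "E \<subseteq> C \<union> D" by auto
  then show "up_refutes ?G"
  proof cases
    case 1
    then have "up_derives ?G ({neg x} - {neg x})"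
      using units[of x] units[of "neg x"] by (intro up_resolve) auto
    then show ?thesis by simp
  next
    case 2
    have "up_derives ?G (E - (C \<union> D))"
      using 2 units fin(1) fin(2)[OF D] by (intro up_strip) (auto intro: up_axiom)
    moreover have "E - (C \<union> D) = {}" using 2 by auto
    ultimately show ?thesis by simp
  qed
qed

text \<open>\<open>n\<close> is an upper bound on the number of lines, hence
  \<open>reach_refl\<close> for every \<open>n\<close>. The set \<open>X\<close> limits added
  clauses only; it later becomes the set of original variables, as DRAT- demands.\<close>

inductive reach :: "'v set \<Rightarrow> 'v cnf \<Rightarrow> nat \<Rightarrow> 'v cnf \<Rightarrow> bool" for X where
  reach_refl: "reach X F n F"
| reach_add: "finite C \<Longrightarrow> AT F C \<or> RAT F C \<Longrightarrow> var ` C \<subseteq> X \<Longrightarrow> reach X (insert C F) n G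
    \<Longrightarrow> reach X F (Suc n) G"
| reach_del: "C \<in> F \<Longrightarrow> AT (F - {C}) C \<or> RAT (F - {C}) C \<Longrightarrow> reach X (F - {C}) n G
    \<Longrightarrow> reach X F (Suc n) G"

lemma reach_trans:
  assumes "reach X F m G" "reach X G n H"
  shows "reach X F (m + n) H"
  using assms
proof (induction rule: reach.induct)
  case (reach_refl F m)
  then show ?case
  proof (induction rule: reach.induct)
    case (reach_add C F n G)
    then show ?case using reach.reach_add[of C F X "m + n" G] by simp
  next
    case (reach_del C F n G)
    then show ?case using reach.reach_del[of C F X "m + n" G] by simp
  qed (rule reach.reach_refl)
qed (auto intro: reach.intros)

lemma reach_mono: "reach X F m G \<Longrightarrow> m \<le> n \<Longrightarrow> reach X F n G"
  using reach_trans[of X F m G "n - m" G] by (simp add: reach_refl)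

text \<open>The extra line is a final \<open>Add {}\<close>, since a refutation must literally end
  with it; it is AT because \<open>{}\<close> is already present.\<close>

lemma reach_refutation:
  assumes "reach X F n G" "{} \<in> G"
  shows "\<exists>\<pi>. drat_refutation F \<pi> \<and> (\<forall>C. Add C \<in> set \<pi> \<longrightarrow> var ` C \<subseteq> X) \<and> length \<pi> \<le> Suc n"
  using assms
proof (induction rule: reach.induct)
  case (reach_refl F n)
  then show ?case
    by (intro exI[of _ "[Add {}]"]) (auto simp: drat_refutation_def intro: AT_subsumed)
next
  case (reach_add C F n G)
  then obtain \<pi> where "drat_refutation (insert C F) \<pi>"
    "\<forall>C. Add C \<in> set \<pi> \<longrightarrow> var ` C \<subseteq> X" "length \<pi> \<le> Suc n" by blast
  with reach_add.hyps show ?case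
    by (intro exI[of _ "Add C # \<pi>"]) (auto simp: drat_refutation_def)
next
  case (reach_del C F n G)
  then obtain \<pi> where "drat_refutation (F - {C}) \<pi>"
    "\<forall>C. Add C \<in> set \<pi> \<longrightarrow> var ` C \<subseteq> X" "length \<pi> \<le> Suc n" by blast
  with reach_del.hyps show ?case
    by (intro exI[of _ "Del C # \<pi>"]) (auto simp: drat_refutation_def)
qed

text \<open>Quantifying over all \<open>G\<close> between \<open>F\<close> and
  \<open>F \<union> \<Delta>\<close> makes the order irrelevant: the clauses of
  \<open>\<Delta>\<close> can be added or deleted one by one, whichever of the others are
  present.\<close>

definition redundant :: "'v cnf \<Rightarrow> 'v cnf \<Rightarrow> bool" where
  "redundant F \<Delta> \<longleftrightarrow> (\<forall>C\<in>\<Delta>. \<forall>G. F \<subseteq> G \<longrightarrow> G \<subseteq> F \<union> \<Delta> \<longrightarrow> AT G C \<or> RAT G C)"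

lemma reach_add_redundant:
  assumes "finite \<Delta>" "redundant F \<Delta>" "\<And>C. C \<in> \<Delta> \<Longrightarrow> finite C \<and> var ` C \<subseteq> X"
  shows "reach X F (card \<Delta>) (F \<union> \<Delta>)"
proof -
  have "reach X F (card \<Delta>') (F \<union> \<Delta>')" if "finite \<Delta>'" "\<Delta>' \<subseteq> \<Delta>" for \<Delta>'
    using that
  proof (induction \<Delta>' rule: finite_induct)
    case (insert C \<Delta>')
    then have "AT (F \<union> \<Delta>') C \<or> RAT (F \<union> \<Delta>') C"
      using assms(2) insert.prems unfolding redundant_def
      by (meson Un_mono insert_subset order_refl sup_ge1)
    then have "reach X (F \<union> \<Delta>') (Suc 0) (insert C (F \<union> \<Delta>'))"
      using assms(3) insert.prems by (intro reach_add[OF _ _ _ reach_refl]) auto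
    then have "reach X (F \<union> \<Delta>') 1 (F \<union> insert C \<Delta>')" by simp
    with insert have "reach X F (card \<Delta>' + 1) (F \<union> insert C \<Delta>')"
      by (intro reach_trans) auto
    with insert show ?case by simp
  qed (simp add: reach_refl)
  with assms show ?thesis by blast
qed

lemma reach_del_redundant:
  assumes "finite \<Delta>" "redundant F \<Delta>"
  shows "reach X (F \<union> \<Delta>) (card \<Delta>) F"
proof -
  have "reach X (F \<union> \<Delta>') (card \<Delta>') F" if "finite \<Delta>'" "\<Delta>' \<subseteq> \<Delta>" for \<Delta>'
    using that
  proof (induction \<Delta>' rule: finite_induct)
    case (insert C \<Delta>')
    have "reach X (F \<union> insert C \<Delta>') 1 (F \<union> \<Delta>')"
    \<comment> \<open>A clause that also belongs to \<open>F\<close> has to stay, so it costs no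
      line.\<close>
    proof (cases "C \<in> F \<union> \<Delta>'")
      case True
      then show ?thesis by (metis Un_insert_right insert_absorb reach_refl)
    next
      case False
      then have "F \<union> insert C \<Delta>' - {C} = F \<union> \<Delta>'" by auto
      moreover have "AT (F \<union> \<Delta>') C \<or> RAT (F \<union> \<Delta>') C"
        using assms(2) insert.prems unfolding redundant_def
        by (meson Un_mono insert_subset order_refl sup_ge1)
      ultimately have "reach X (F \<union> insert C \<Delta>') (Suc 0) (F \<union> \<Delta>')"
        using reach_del[OF _ _ reach_refl, of C "F \<union> insert C \<Delta>'" X 0] by simp
      then show ?thesis by simp
    qed
    with insert have "reach X (F \<union> insert C \<Delta>') (1 + card \<Delta>') F"
      by (intro reach_trans) auto
    with insert show ?case by simp
  qed (simp add: reach_refl)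
  with assms show ?thesis by blast
qed

lemma redundant_AT: "(\<And>C. C \<in> \<Delta> \<Longrightarrow> AT F C) \<Longrightarrow> redundant F \<Delta>"
  unfolding redundant_def using AT_mono by blast

text \<open>Each clause may take several lines, provided its auxiliary clauses are gone at the end.
  Demanding this over every superset \<open>G\<close> lets the derivations be chained.\<close>

lemma reach_add_set:
  assumes "finite \<Delta>" "\<And>C G. C \<in> \<Delta> \<Longrightarrow> F \<subseteq> G \<Longrightarrow> reach X G m (insert C G)"
  shows "reach X F (m * card \<Delta>) (F \<union> \<Delta>)"
  using assms
proof (induction \<Delta> rule: finite_induct)
  case (insert C \<Delta>)
  then have "reach X F (m * card \<Delta> + m) (insert C (F \<union> \<Delta>))"
    by (intro reach_trans[of X F "m * card \<Delta>" "F \<union> \<Delta>"]) auto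
  with insert show ?case by (simp add: add.commute)
qed (simp add: reach_refl)

section \<open>Clauses as excluded partial assignments\<close>

definition falsified :: "('v \<Rightarrow> bool) \<Rightarrow> 'v set \<Rightarrow> 'v clause" where
  "falsified I V = (\<lambda>v. if I v then Neg v else Pos v) ` V"

lemma finite_falsified: "finite V \<Longrightarrow> finite (falsified I V)"
  by (simp add: falsified_def)

lemma var_falsified [simp]: "var ` falsified I V = V"
proof -
  have "var (if I v then Neg v else Pos v) = v" for v by simp
  then show ?thesis unfolding falsified_def image_image by simp
qed

lemma falsified_mono: "(\<And>v. v \<in> V \<Longrightarrow> v \<in> W \<and> I v = J v) \<Longrightarrow> falsified I V \<subseteq> falsified J W"
  by (force simp: falsified_def)

lemma falsified_cong: "(\<And>v. v \<in> V \<Longrightarrow> I v = J v) \<Longrightarrow> falsified I V = falsified J V"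
  by (rule antisym; rule falsified_mono) auto

lemma falsified_iff: "l \<in> falsified I V \<longleftrightarrow> var l \<in> V \<and> \<not> lit_true I l"
  by (cases l) (auto simp: falsified_def)

text \<open>Full clauses over \<open>W\<close> are subsumed by \<open>\<Gamma>\<close>; the variables outside \<open>W'\<close> are then resolved away.\<close>
lemma reach_implied:
  assumes "finite W" "W' \<subseteq> W" "W \<subseteq> X" "\<Gamma> \<subseteq> F" "\<And>D. D \<in> \<Gamma> \<Longrightarrow> var ` D \<subseteq> W"
    and "\<And>J. (\<And>v. v \<in> W' \<Longrightarrow> J v = I v) \<Longrightarrow> \<exists>D\<in>\<Gamma>. \<forall>l\<in>D. \<not> lit_true J l"
  shows "reach X F (4 * 2 ^ card (W - W') - 3) (insert (falsified I W') F)"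
  using assms
proof (induction "card (W - W')" arbitrary: W' I F)
  case 0
  then have W: "W' = W" by auto
  from 0(7)[of I] obtain D where D: "D \<in> \<Gamma>" "\<forall>l\<in>D. \<not> lit_true I l" by auto
  have "var ` D \<subseteq> W" using D 0 by blast
  with D have "D \<subseteq> falsified I W'" by (auto simp: W falsified_iff)
  with D 0 have "AT F (falsified I W')"
    by (intro AT_subsumed[of D]) (auto simp: W finite_falsified)
  then have "reach X F (Suc 0) (insert (falsified I W') F)"
    using 0 by (intro reach_add[OF _ _ _ reach_refl]) (auto simp: finite_falsified W)
  with W show ?case by simp
next
  case (Suc n)
  have "W - W' \<noteq> {}" using Suc.hyps(2) by (metis card.empty nat.distinct(1))
  then obtain v where v: "v \<in> W" "v \<notin> W'" by blast
  have "W - insert v W' = W - W' - {v}" by auto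
  then have n: "n = card (W - insert v W')"
    using Suc.hyps(2)[symmetric] Suc.prems(1) v by simp
  have W'fin: "finite W'" using Suc.prems finite_subset by auto
  \<comment> \<open>Branch on a variable \<open>v\<close> still to be eliminated: the two wider
    clauses come from the induction hypothesis and resolve on \<open>v\<close> to the wanted one,
    which then subsumes both.\<close>
  define C where "C b = falsified (I(v := b)) (insert v W')" for b
  let ?C = "falsified I W'" and ?m = "4 * 2 ^ n - 3 :: nat"
  have C: "reach X G ?m (insert (C b) G)" if "F \<subseteq> G" for G b
    unfolding C_def n
  proof (rule Suc.hyps(1)[OF n])
    fix J assume J: "\<And>w. w \<in> insert v W' \<Longrightarrow> J w = (I(v := b)) w"
    have "J w = I w" if "w \<in> W'" for w using J[of w] v that by (metis fun_upd_other insertI2)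
    then show "\<exists>D\<in>\<Gamma>. \<forall>l\<in>D. \<not> lit_true J l" by (rule Suc.prems(6))
  next
    show "insert v W' \<subseteq> W" using Suc.prems(2) v by simp
    show "\<Gamma> \<subseteq> G" using Suc.prems(4) that by simp
    show "finite W" "W \<subseteq> X" by (fact Suc.prems)+
    show "var ` D \<subseteq> W" if "D \<in> \<Gamma>" for D using that by (fact Suc.prems)
  qed
  have sub: "?C \<subseteq> C b" for b
    unfolding C_def by (rule falsified_mono) (use v in auto)
  have C_eq: "C b = insert (if b then Neg v else Pos v) ?C" for b
    using v by (auto simp: C_def falsified_def)
  let ?F2 = "insert (C False) (insert (C True) F)"
  let ?F3 = "insert ?C ?F2"
  have r1: "reach X F (?m + ?m) ?F2"
    by (rule reach_trans[OF C C]) auto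
  have "AT ?F2 ?C"
    by (rule AT_resolvent[of "C True" _ "Neg v" _ "C False"]) (use W'fin in \<open>auto simp: C_eq finite_falsified\<close>)
  then have r2: "reach X ?F2 1 ?F3"
    using Suc.prems W'fin unfolding One_nat_def
    by (intro reach_add[OF _ _ _ reach_refl]) (auto simp: finite_falsified)
  have "redundant (insert ?C F) {C True, C False}"
    by (rule redundant_AT, rule AT_subsumed[of ?C]) (use W'fin sub in \<open>auto simp: C_eq finite_falsified\<close>)
  from reach_del_redundant[OF _ this, of X]
  have "reach X ?F3 (card {C True, C False}) (insert ?C F)"
    by (simp add: insert_commute)
  then have r3: "reach X ?F3 2 (insert ?C F)"
    by (rule reach_mono) (simp add: card_insert_if)
  \<comment> \<open>Two branches, one resolvent, two deletions: the recurrence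
    \<open>m (k + 1) = 2 * m k + 3\<close> with \<open>m 0 = 1\<close> has the solution
    \<open>4 * 2 ^ k - 3\<close>.\<close>
  have "reach X F (?m + ?m + 1 + 2) (insert ?C F)"
    by (rule reach_trans[OF reach_trans[OF r1 r2] r3])
  then have "reach X F (4 * 2 ^ Suc n - 3) (insert ?C F)"
  proof (rule reach_mono)
    have "(1 :: nat) \<le> 2 ^ n" by simp
    then show "?m + ?m + 1 + 2 \<le> 4 * 2 ^ Suc n - 3" unfolding power_Suc by arith
  qed
  then show ?case by (simp only: Suc.hyps(2))
qed

subsection \<open>Parity gates\<close>

definition par :: "('a \<Rightarrow> bool) \<Rightarrow> 'a set \<Rightarrow> bool" where
  "par I V \<longleftrightarrow> odd (card {v \<in> V. I v})"

lemma par_empty [simp]: "\<not> par I {}"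
  by (simp add: par_def)

lemma par_insert: "finite V \<Longrightarrow> v \<notin> V \<Longrightarrow> par I (insert v V) \<longleftrightarrow> I v \<noteq> par I V"
proof -
  assume "finite V" "v \<notin> V"
  moreover have "{w \<in> insert v V. I w} = (if I v then insert v {w \<in> V. I w} else {w \<in> V. I w})"
    by auto
  ultimately show ?thesis by (simp add: par_def)
qed

lemma par_cong: "(\<And>v. v \<in> V \<Longrightarrow> I v = J v) \<Longrightarrow> par I V = par J V"
  unfolding par_def by (metis (mono_tags, lifting) Collect_cong)

lemma par_Un: "finite V \<Longrightarrow> finite W \<Longrightarrow> V \<inter> W = {} \<Longrightarrow> par I (V \<union> W) \<longleftrightarrow> par I V \<noteq> par I W"
  by (induction V rule: finite_induct) (auto simp: par_insert)

text \<open>Common variables are counted in both sets and cancel modulo 2; this is what makes the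
  sum of two gates a gate on the symmetric difference.\<close>

lemma par_sym_diff:
  assumes "finite V" "finite W"
  shows "par I (sym_diff V W) \<longleftrightarrow> par I V \<noteq> par I W"
proof -
  have "par I (sym_diff V W) \<longleftrightarrow> par I (V - W) \<noteq> par I (W - V)"
    by (intro par_Un) (use assms in auto)
  moreover have "par I V \<longleftrightarrow> par I (V - W) \<noteq> par I (V \<inter> W)"
    using par_Un[of "V - W" "V \<inter> W" I] assms by (simp add: Un_Diff_Int disjoint_iff)
  moreover have "par I W \<longleftrightarrow> par I (W - V) \<noteq> par I (W \<inter> V)"
    using par_Un[of "W - V" "W \<inter> V" I] assms by (simp add: Un_Diff_Int disjoint_iff)
  ultimately show ?thesis unfolding Int_commute[of W V]
    by (cases "par I (V - W)"; cases "par I (W - V)"; cases "par I (V \<inter> W)"; simp)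
qed

lemma par_flip:
  assumes "finite V" "t \<in> V" "I t \<noteq> J t" "\<And>v. v \<in> V - {t} \<Longrightarrow> I v = J v"
  shows "par I V \<longleftrightarrow> \<not> par J V"
proof -
  have V: "V = insert t (V - {t})" using assms by auto
  have "par K V \<longleftrightarrow> K t \<noteq> par K (V - {t})" for K
    by (subst V, rule par_insert) (use assms in auto)
  moreover have "par I (V - {t}) = par J (V - {t})" using assms(4) by (rule par_cong)
  ultimately show ?thesis using assms(3) by blast
qed

text \<open>The constraint that the variables of \<open>V\<close> sum to \<open>c\<close> modulo 2,
  with one full clause per violating assignment. Signs of literals are absorbed into the charge
  \<open>c\<close>, so sums of constraints need only sets and charges.\<close>

definition gate :: "'v set \<Rightarrow> bool \<Rightarrow> 'v cnf" where
  "gate V c = {falsified I V | I. par I V \<noteq> c}"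

lemma gateE:
  assumes "C \<in> gate V c"
  obtains I where "C = falsified I V" "par I V \<noteq> c"
  using assms by (auto simp: gate_def)

lemma gateI: "par I V \<noteq> c \<Longrightarrow> falsified I V \<in> gate V c"
  by (auto simp: gate_def)

lemma var_gate: "C \<in> gate V c \<Longrightarrow> var ` C = V"
  by (metis gateE var_falsified)

lemma finite_in_gate: "finite V \<Longrightarrow> C \<in> gate V c \<Longrightarrow> finite C"
  by (auto simp: gate_def finite_falsified)

lemma finite_gate_card:
  assumes "finite V"
  shows "finite (gate V c)" "card (gate V c) \<le> 2 ^ card V"
proof -
  have sub: "gate V c \<subseteq> (\<lambda>M. falsified (\<lambda>v. v \<in> M) V) ` Pow V"
  proof
    fix C assume "C \<in> gate V c"
    then obtain I where "C = falsified I V" by (rule gateE)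
    moreover have "falsified I V = falsified (\<lambda>v. v \<in> {v \<in> V. I v}) V"
      by (rule falsified_cong) simp
    ultimately have "C = falsified (\<lambda>v. v \<in> {v \<in> V. I v}) V" by simp
    then show "C \<in> (\<lambda>M. falsified (\<lambda>v. v \<in> M) V) ` Pow V" by blast
  qed
  then show "finite (gate V c)" by (rule finite_subset) (use assms in simp)
  have "card (gate V c) \<le> card (Pow V)"
    by (rule surj_card_le[OF _ sub]) (use assms in simp)
  then show "card (gate V c) \<le> 2 ^ card V" using assms by (simp add: card_Pow)
qed

text \<open>The constraint \<open>0 = 1\<close> is literally the empty clause and
  \<open>0 = 0\<close> is no clause at all: a gate without variables either ends the refutation or
  vanishes for free.\<close>

lemma gate_empty: "gate {} True = {{}}" "gate {} False = {}"
  by (auto simp: gate_def falsified_def)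

lemma vars_gate:
  assumes "finite V" "V \<noteq> {}"
  shows "vars (gate V c) = V"
proof -
  obtain v where v: "v \<in> V" using assms by blast
  have "par (\<lambda>w. w = v) V \<longleftrightarrow> \<not> par (\<lambda>w. False) V"
    by (rule par_flip[of V v]) (use assms v in auto)
  then obtain I where "par I V \<noteq> c" by metis
  then have "falsified I V \<in> gate V c" by (rule gateI)
  then have "V \<subseteq> vars (gate V c)"
    unfolding vars_def by (metis image_mono Union_upper var_falsified)
  moreover have "vars (gate V c) \<subseteq> V" using var_gate unfolding vars_def by fastforce
  ultimately show ?thesis by blast
qed

abbreviation gate_sum :: "'v set \<Rightarrow> bool \<Rightarrow> 'v set \<Rightarrow> bool \<Rightarrow> 'v cnf" where
  "gate_sum V1 c1 V2 c2 \<equiv> gate (sym_diff V1 V2) (c1 \<noteq> c2)"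

text \<open>However an assignment violating the sum is extended to the common variables, it violates
  one of the two gates. So each clause of the sum is implied by the gates, and
  \<open>reach_implied\<close> resolves the common variables away.\<close>

lemma reach_gate_sum:
  assumes "finite V1" "finite V2" "V1 \<union> V2 \<subseteq> X" "gate V1 c1 \<union> gate V2 c2 \<subseteq> F"
  shows "reach X F (4 * 2 ^ card (V1 \<union> V2) * 2 ^ card (sym_diff V1 V2)) (F \<union> gate_sum V1 c1 V2 c2)"
proof -
  let ?m = "4 * 2 ^ card (V1 \<union> V2) :: nat" and ?E = "gate_sum V1 c1 V2 c2"
  have "reach X F (?m * card ?E) (F \<union> ?E)"
  proof (rule reach_add_set)
    show "finite ?E" using assms by (intro finite_gate_card) auto
    fix C G assume C: "C \<in> ?E" and G: "F \<subseteq> G"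
    from C obtain I where I: "C = falsified I (sym_diff V1 V2)" "par I (sym_diff V1 V2) \<noteq> (c1 \<noteq> c2)"
      by (rule gateE)
    have "reach X G (4 * 2 ^ card ((V1 \<union> V2) - sym_diff V1 V2) - 3) (insert C G)"
      unfolding I(1)
    proof (rule reach_implied[where \<Gamma> = "gate V1 c1 \<union> gate V2 c2"])
      fix J assume J: "\<And>v. v \<in> sym_diff V1 V2 \<Longrightarrow> J v = I v"
      then have "par J (sym_diff V1 V2) = par I (sym_diff V1 V2)" by (rule par_cong)
      with I(2) assms have "par J V1 \<noteq> c1 \<or> par J V2 \<noteq> c2" by (auto simp: par_sym_diff)
      then have "falsified J V1 \<in> gate V1 c1 \<or> falsified J V2 \<in> gate V2 c2" using gateI by blast
      then show "\<exists>D\<in>gate V1 c1 \<union> gate V2 c2. \<forall>l\<in>D. \<not> lit_true J l"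
        by (metis UnCI falsified_iff)
    next
      fix D assume "D \<in> gate V1 c1 \<union> gate V2 c2"
      then show "var ` D \<subseteq> V1 \<union> V2" using var_gate by blast
    qed (use assms G in auto)
    moreover have "(4 :: nat) * 2 ^ card ((V1 \<union> V2) - sym_diff V1 V2) - 3 \<le> ?m"
    proof -
      have "card ((V1 \<union> V2) - sym_diff V1 V2) \<le> card (V1 \<union> V2)"
        using assms by (intro card_mono) auto
      then have "(2 :: nat) ^ card ((V1 \<union> V2) - sym_diff V1 V2) \<le> 2 ^ card (V1 \<union> V2)"
        by (intro power_increasing) auto
      then show ?thesis by linarith
    qed
    ultimately show "reach X G ?m (insert C G)" by (rule reach_mono)
  qed
  moreover have "card ?E \<le> 2 ^ card (sym_diff V1 V2)" using assms by (intro finite_gate_card) auto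
  ultimately show ?thesis by (auto elim!: reach_mono)
qed

text \<open>
  The only resolvents on \<open>t\<close> are between the two gates; each is tautological or subsumed by a clause
  of their sum.
\<close>
lemma redundant_gates:
  assumes fin: "finite V1" "finite V2" "\<And>D. D \<in> F \<Longrightarrow> finite D"
    and t: "t \<in> V1" "t \<in> V2" "t \<notin> vars F" and sum: "gate_sum V1 c1 V2 c2 \<subseteq> F"
  shows "redundant F (gate V1 c1 \<union> gate V2 c2)"
  unfolding redundant_def
proof (intro ballI allI impI disjI2)
  fix C G assume C: "C \<in> gate V1 c1 \<union> gate V2 c2"
    and G: "F \<subseteq> G" "G \<subseteq> F \<union> (gate V1 c1 \<union> gate V2 c2)"
  \<comment> \<open>\<open>C\<close> and its resolution partner may come from either gate; the pair
    set treats the four combinations at once.\<close>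
  define gs where "gs = {(V1, c1), (V2, c2)}"
  have gs: "finite V \<and> t \<in> V" if "(V, c) \<in> gs" for V c using that fin t by (auto simp: gs_def)
  from C obtain V c where V: "(V, c) \<in> gs" "C \<in> gate V c" by (auto simp: gs_def)
  from V(2) obtain I where I: "C = falsified I V" "par I V \<noteq> c" by (rule gateE)
  define l where "l = (if I t then Neg t else Pos t)"
  have neg_l: "neg l = (if I t then Pos t else Neg t)" by (simp add: l_def)
  show "RAT G C"
  proof (rule RAT_resolvents[of l])
    show "l \<in> C" using I(1) gs[OF V(1)] by (auto simp: l_def falsified_def)
    show "finite C" using I(1) gs[OF V(1)] by (simp add: finite_falsified)
    show "finite D" if "D \<in> G" for D
    proof -
      from that G consider "D \<in> F" | "D \<in> gate V1 c1" | "D \<in> gate V2 c2" by blast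
      then show ?thesis by cases (use fin finite_in_gate in blast)+
    qed
    fix D assume D: "D \<in> G" "neg l \<in> D"
    then have "t \<in> var ` D" by (metis imageI l_def lit.sel neg.simps var_neg)
    then have "D \<notin> F" using t(3) by (auto simp: vars_def)
    with D G have "D \<in> gate V1 c1 \<union> gate V2 c2" by blast
    then obtain W d where W: "(W, d) \<in> gs" "D \<in> gate W d" unfolding gs_def by blast
    from W(2) obtain J where J: "D = falsified J W" "par J W \<noteq> d" by (rule gateE)
    have Jt: "J t \<noteq> I t" using D(2) by (auto simp: J(1) falsified_iff neg_l split: if_splits)
    show "(\<exists>x\<in>C. x \<noteq> l \<and> neg x \<in> D) \<or> (\<exists>E\<in>G. E \<subseteq> (C - {l}) \<union> (D - {neg l}))"
    proof (cases "\<exists>v\<in>V \<inter> W - {t}. I v \<noteq> J v")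
      case True
      then obtain v where v: "v \<in> V" "v \<in> W" "v \<noteq> t" "I v \<noteq> J v" by blast
      let ?x = "if I v then Neg v else Pos v"
      have "?x \<in> C" using v by (auto simp: I(1) falsified_def)
      moreover have "?x \<noteq> l" using v(3) by (auto simp: l_def)
      moreover have "neg ?x \<in> D" using v by (auto simp: J(1) falsified_iff)
      ultimately show ?thesis by blast
    next
      case False
      then have agree: "I v = J v" if "v \<in> V" "v \<in> W" "v \<noteq> t" for v using that by blast
      \<comment> \<open>Two clauses of the same gate that agree off \<open>t\<close> would exclude
        assignments of opposite parity, yet both assignments violate the same charge.\<close>
      have "(V, c) \<noteq> (W, d)"
      proof
        assume eq: "(V, c) = (W, d)"
        then have "par I V \<longleftrightarrow> \<not> par J V"
          by (intro par_flip[of V t]) (use gs[OF V(1)] Jt agree in auto)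
        with I(2) J(2) eq show False by auto
      qed
      then have sum': "gate_sum V c W d \<subseteq> G"
        using V(1) W(1) sum G by (auto simp: gs_def Un_commute)
      \<comment> \<open>Glue the two excluded assignments, taking \<open>t\<close> from
        \<open>I\<close>. On \<open>W\<close> this differs from \<open>J\<close> exactly at
        \<open>t\<close>, which flips that parity, so \<open>K\<close> violates the sum; its clause
        there avoids \<open>t\<close> and lies inside the resolvent.\<close>
      define K where "K v = (if v \<in> V then I v else J v)" for v
      have "par K V = par I V" by (rule par_cong) (simp add: K_def)
      moreover have "par K W \<longleftrightarrow> \<not> par J W"
        by (rule par_flip[of W t]) (use gs[OF V(1)] gs[OF W(1)] Jt agree in \<open>auto simp: K_def\<close>)
      moreover have "par K (sym_diff V W) \<longleftrightarrow> par K V \<noteq> par K W"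
        using gs[OF V(1)] gs[OF W(1)] by (intro par_sym_diff) simp_all
      ultimately have "par K (sym_diff V W) \<noteq> (c \<noteq> d)"
        using I(2) J(2) by (cases c; cases d; simp)
      then have "falsified K (sym_diff V W) \<in> gate_sum V c W d" by (rule gateI)
      then have "falsified K (sym_diff V W) \<in> G" by (rule subsetD[OF sum'])
      moreover have "falsified K (sym_diff V W) \<subseteq> (C - {l}) \<union> (D - {neg l})"
      proof
        fix x assume x: "x \<in> falsified K (sym_diff V W)"
        then have "var x \<noteq> t" using gs[OF V(1)] gs[OF W(1)] by (auto simp: falsified_iff)
        then have "x \<noteq> l" "x \<noteq> neg l" by (auto simp: l_def)
        moreover have "x \<in> falsified I V \<or> x \<in> falsified J W"
          using x by (cases x) (auto simp: falsified_iff K_def)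
        ultimately show "x \<in> (C - {l}) \<union> (D - {neg l})" by (auto simp: I(1) J(1))
      qed
      ultimately show ?thesis by blast
    qed
  qed
qed

text \<open>With a single common variable one resolution suffices: if \<open>t := b\<close> makes
  \<open>I\<close> violate the first gate, then \<open>t := \<not> b\<close> makes it violate the
  second, and the two clauses resolve on \<open>t\<close>. This lets the sum be deleted after an
  exchange.\<close>

lemma AT_gate_sum:
  assumes fin: "finite V1" "finite V2" and t: "V1 \<inter> V2 = {t}" and C: "C \<in> gate_sum V1 c1 V2 c2"
  shows "AT (gate V1 c1 \<union> gate V2 c2) C"
proof -
  obtain I where I: "C = falsified I (sym_diff V1 V2)" "par I (sym_diff V1 V2) \<noteq> (c1 \<noteq> c2)"
    using C by (rule gateE)
  have par_upd: "par (I(t := b)) V \<longleftrightarrow> \<not> par (I(t := \<not> b)) V" if "V \<in> {V1, V2}" for V b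
    by (rule par_flip[of V t]) (use that fin t in auto)
  obtain b where b: "par (I(t := b)) V1 \<noteq> c1" using par_upd[of V1 True] by auto
  have "par (I(t := b)) (sym_diff V1 V2) = par I (sym_diff V1 V2)"
    by (rule par_cong) (use t in auto)
  with b I(2) fin have "par (I(t := \<not> b)) V2 \<noteq> c2"
    using par_upd[of V2 b] by (auto simp: par_sym_diff)
  then have 2: "falsified (I(t := \<not> b)) V2 \<in> gate V2 c2" by (rule gateI)
  have 1: "falsified (I(t := b)) V1 \<in> gate V1 c1" using b by (rule gateI)
  show ?thesis
  proof (rule AT_resolvent[where l = "if b then Neg t else Pos t"])
    show "falsified (I(t := b)) V1 \<in> gate V1 c1 \<union> gate V2 c2" using 1 by blast
    show "falsified (I(t := \<not> b)) V2 \<in> gate V1 c1 \<union> gate V2 c2" using 2 by blast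
    have V: "v = t \<or> v \<notin> V2" if "v \<in> V1" for v using that t by auto
    have W: "v = t \<or> v \<notin> V1" if "v \<in> V2" for v using that t by auto
    show "falsified (I(t := b)) V1 \<subseteq> insert (if b then Neg t else Pos t) C"
      unfolding I(1) falsified_def using V by (auto split: if_splits)
    show "falsified (I(t := \<not> b)) V2 \<subseteq> insert (neg (if b then Neg t else Pos t)) C"
      unfolding I(1) falsified_def using W by (auto split: if_splits)
    show "finite C" using fin by (simp add: I(1) finite_falsified)
  qed
qed

text \<open>\<open>2064 = (4 * 2^5) * 2^4 + 2 * 2^3\<close>: derive the clauses of the sum, then delete both gates.\<close>
lemma reach_contract:
  assumes fin: "finite V1" "finite V2" "\<And>D. D \<in> F \<Longrightarrow> finite D"
    and card: "card V1 \<le> 3" "card V2 \<le> 3" "card (sym_diff V1 V2) \<le> 4" and X: "V1 \<union> V2 \<subseteq> X"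
    and t: "t \<in> V1" "t \<in> V2" "t \<notin> vars F"
  shows "reach X (F \<union> gate V1 c1 \<union> gate V2 c2) 2064 (F \<union> gate_sum V1 c1 V2 c2)"
proof -
  let ?G = "gate V1 c1 \<union> gate V2 c2" and ?E = "gate_sum V1 c1 V2 c2"
  have U: "card (V1 \<union> V2) \<le> 5"
    using card_Un_Int[OF fin(1,2)] t card fin card_gt_0_iff[of "V1 \<inter> V2"] by auto
  have "(4 * 2 ^ card (V1 \<union> V2)) * 2 ^ card (sym_diff V1 V2) \<le> (4 * 2 ^ 5 :: nat) * 2 ^ 4"
    using U card by (intro mult_mono power_increasing) auto
  then have "reach X (F \<union> ?G) 2048 (F \<union> ?G \<union> ?E)"
    using reach_gate_sum[of V1 V2 X c1 c2 "F \<union> ?G"] fin X by (auto elim!: reach_mono)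
  moreover have "redundant (F \<union> ?E) ?G"
  proof (rule redundant_gates[OF fin(1,2) _ t(1,2)])
    show "t \<notin> vars (F \<union> ?E)"
      using t var_gate[of _ "sym_diff V1 V2"] by (fastforce simp: vars_def)
    show "finite D" if "D \<in> F \<union> ?E" for D
      using that fin finite_in_gate[of "sym_diff V1 V2" D] by auto
  qed auto
  then have "reach X (F \<union> ?E \<union> ?G) (card ?G) (F \<union> ?E)"
    using fin by (intro reach_del_redundant) (auto simp: finite_gate_card)
  then have "reach X (F \<union> ?G \<union> ?E) 16 (F \<union> ?E)"
  proof -
    have "card ?G \<le> card (gate V1 c1) + card (gate V2 c2)" by (rule card_Un_le)
    also have "\<dots> \<le> 2 ^ card V1 + 2 ^ card V2"
      using fin by (intro add_mono finite_gate_card)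
    also have "\<dots> \<le> 2 ^ 3 + 2 ^ 3" using card by (intro add_mono power_increasing) auto
    finally show ?thesis
      using \<open>reach X (F \<union> ?E \<union> ?G) (card ?G) (F \<union> ?E)\<close> by (auto elim!: reach_mono simp: Un_ac)
  qed
  ultimately show ?thesis using reach_trans[of X _ 2048 _ 16] by (simp add: Un_assoc)
qed

text \<open>The sum is the halfway point: no clause mentions \<open>t\<close> there, so any two
  gates meeting in \<open>t\<close> with the same sum can be introduced by RAT. The cost
  \<open>2064 + 16 + 16\<close> is rounded up to a power of two.\<close>

lemma reach_exchange:
  assumes fin: "finite V1" "finite V2" "finite W1" "finite W2" "\<And>D. D \<in> F \<Longrightarrow> finite D"
    and card: "card V1 \<le> 3" "card V2 \<le> 3" "card W1 \<le> 3" "card W2 \<le> 3"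
    and X: "V1 \<union> V2 \<subseteq> X"
    and V: "V1 \<inter> V2 = {t}" and W: "W1 \<inter> W2 = {t}" and sum: "sym_diff W1 W2 = sym_diff V1 V2"
    and t: "t \<notin> vars F"
  shows "reach X (F \<union> gate V1 c1 \<union> gate V2 c2) 4096 (F \<union> gate W1 c1 \<union> gate W2 c2)"
proof -
  let ?G = "gate W1 c1 \<union> gate W2 c2" and ?E = "gate_sum V1 c1 V2 c2"
  have "card V1 = card (V1 - V2) + 1" "card V2 = card (V2 - V1) + 1"
    using card_Int_Diff[OF fin(1), of V2] card_Int_Diff[OF fin(2), of V1] V by (auto simp: Int_commute)
  then have S4: "card (sym_diff V1 V2) \<le> 4"
    using card_Un_le[of "V1 - V2" "V2 - V1"] card by linarith
  have "W1 \<union> W2 = insert t (sym_diff W1 W2)" using W by blast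
  with sum V X have X': "W1 \<union> W2 \<subseteq> X" by blast
  have r1: "reach X (F \<union> gate V1 c1 \<union> gate V2 c2) 2064 (F \<union> ?E)"
    by (rule reach_contract[of _ _ _ _ t]) (use fin card S4 X V t in auto)
  have "redundant (F \<union> ?E) ?G"
  proof (rule redundant_gates[OF fin(3,4), of _ t])
    show "t \<notin> vars (F \<union> ?E)"
      using t V var_gate[of _ "sym_diff V1 V2"] by (fastforce simp: vars_def)
    show "finite D" if "D \<in> F \<union> ?E" for D
      using that fin finite_in_gate[of "sym_diff V1 V2" D] by auto
  qed (use W sum in auto)
  then have "reach X (F \<union> ?E) (card ?G) (F \<union> ?E \<union> ?G)"
  proof (rule reach_add_redundant[rotated])
    fix C assume "C \<in> ?G"
    then consider "C \<in> gate W1 c1" | "C \<in> gate W2 c2" by blast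
    then show "finite C \<and> var ` C \<subseteq> X"
      by cases (use X' in \<open>simp_all add: var_gate finite_in_gate[OF fin(3)] finite_in_gate[OF fin(4)]\<close>)
  qed (use fin in \<open>simp add: finite_gate_card\<close>)
  then have r2: "reach X (F \<union> ?E) 16 (F \<union> ?E \<union> ?G)"
  proof (rule reach_mono)
    have "card ?G \<le> card (gate W1 c1) + card (gate W2 c2)" by (rule card_Un_le)
    also have "\<dots> \<le> 2 ^ card W1 + 2 ^ card W2"
      using fin by (intro add_mono finite_gate_card)
    also have "\<dots> \<le> 2 ^ 3 + 2 ^ 3" using card by (intro add_mono power_increasing) auto
    finally show "card ?G \<le> 16" by simp
  qed
  have "redundant (F \<union> ?G) ?E"
    using AT_gate_sum[OF fin(3,4) W] by (intro redundant_AT) (auto simp: sum intro: AT_mono)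
  then have "reach X (F \<union> ?G \<union> ?E) (card ?E) (F \<union> ?G)"
    using fin by (intro reach_del_redundant) (auto simp: finite_gate_card)
  then have "reach X (F \<union> ?G \<union> ?E) 16 (F \<union> ?G)"
  proof (rule reach_mono)
    have "card ?E \<le> 2 ^ card (sym_diff V1 V2)" using fin by (intro finite_gate_card) auto
    also have "\<dots> \<le> 2 ^ 4" using S4 by (intro power_increasing) auto
    finally show "card ?E \<le> 16" by simp
  qed
  then have r3: "reach X (F \<union> ?E \<union> ?G) 16 (F \<union> ?G)" by (simp only: Un_ac)
  have "reach X (F \<union> gate V1 c1 \<union> gate V2 c2) 4096 (F \<union> ?G)"
    by (rule reach_mono[OF reach_trans[OF reach_trans[OF r1 r2] r3]]) simp
  then show ?thesis by (simp only: Un_assoc)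
qed

subsection \<open>Short cycles in graphs of minimum degree three\<close>

text \<open>Walks that never turn back along the edge just used. They are easy to count, and unlike
  arbitrary closed walks, the closed ones always contain a cycle.\<close>

fun nonbacktracking :: "('a \<Rightarrow> 'a \<Rightarrow> bool) \<Rightarrow> 'a list \<Rightarrow> bool" where
  "nonbacktracking adj [] \<longleftrightarrow> True"
| "nonbacktracking adj [x] \<longleftrightarrow> True"
| "nonbacktracking adj [x, y] \<longleftrightarrow> adj x y"
| "nonbacktracking adj (x # y # z # w) \<longleftrightarrow> adj x y \<and> x \<noteq> z \<and> nonbacktracking adj (y # z # w)"

lemma nonbacktracking_Cons: "nonbacktracking adj (x # y # w) \<longleftrightarrow> adj x y \<and> (w \<noteq> [] \<longrightarrow> hd w \<noteq> x) \<and> nonbacktracking adj (y # w)"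
  by (cases w) auto

lemma nonbacktracking_tl: "nonbacktracking adj (x # w) \<Longrightarrow> nonbacktracking adj w"
  by (cases w) (auto simp: nonbacktracking_Cons)

lemma nonbacktracking_append1: "nonbacktracking adj (xs @ ys) \<Longrightarrow> nonbacktracking adj xs"
proof (induction xs)
  case (Cons x xs)
  then have "nonbacktracking adj xs" using nonbacktracking_tl by fastforce
  with Cons.prems show ?case
  proof (cases xs)
    case (Cons y zs)
    with \<open>nonbacktracking adj xs\<close> Cons.prems show ?thesis by (cases zs) (auto simp: nonbacktracking_Cons)
  qed simp
qed simp

lemma nonbacktracking_append2: "nonbacktracking adj (xs @ ys) \<Longrightarrow> nonbacktracking adj ys"
  by (induction xs) (auto dest: nonbacktracking_tl)

lemma nonbacktracking_join:
  "nonbacktracking adj (xs @ [h]) \<Longrightarrow> nonbacktracking adj (h # ys) \<Longrightarrow> xs \<noteq> [] \<Longrightarrow> ys \<noteq> [] \<Longrightarrow> last xs \<noteq> hd ys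
    \<Longrightarrow> nonbacktracking adj (xs @ h # ys)"
proof (induction xs)
  case (Cons x xs)
  show ?case
  proof (cases xs)
    case Nil
    with Cons.prems show ?thesis by (auto simp: nonbacktracking_Cons)
  next
    case (Cons y zs)
    then show ?thesis using Cons.prems Cons.IH by (cases zs) (auto simp: nonbacktracking_Cons)
  qed
qed simp

lemma nonbacktracking_rev:
  assumes "symp adj" "nonbacktracking adj w"
  shows "nonbacktracking adj (rev w)"
  using assms(2)
proof (induction w rule: induct_list012)
  case (3 x y w)
  from 3 have IH: "nonbacktracking adj (rev w @ [y])" by (simp add: nonbacktracking_Cons)
  have yx: "nonbacktracking adj [y, x]" using 3 assms(1) by (auto simp: nonbacktracking_Cons dest: sympD)
  show ?case
  proof (cases "w = []")
    case True
    with yx show ?thesis by simp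
  next
    case False
    with 3 have "last (rev w) \<noteq> hd [x]" by (simp add: nonbacktracking_Cons last_rev)
    with False have "nonbacktracking adj (rev w @ y # [x])" by (intro nonbacktracking_join[OF IH yx]) simp_all
    then show ?thesis by simp
  qed
qed auto

text \<open>Discard the common beginning. Where the walks part, go back along \<open>p\<close> and
  forth along \<open>q\<close>: the turning point is no backtrack because the next vertices differ,
  and the result is closed because both walks end at the same vertex.\<close>

lemma closed_nonbacktracking:
  assumes "symp adj" "nonbacktracking adj p" "nonbacktracking adj q" "p \<noteq> q" "length p = length q"
    and "hd p = hd q" "last p = last q"
  shows "\<exists>w. nonbacktracking adj w \<and> 2 \<le> length w \<and> length w < 2 * length p \<and> hd w = last w \<and> set w \<subseteq> set p \<union> set q"
  using assms(2-)
proof (induction p arbitrary: q)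
  case (Cons h p)
  from Cons.prems obtain q' where q: "q = h # q'" by (cases q) auto
  with Cons.prems have "p \<noteq> q'" "length p = length q'" by auto
  then have ne: "p \<noteq> []" "q' \<noteq> []" by auto
  show ?case
  proof (cases "hd p = hd q'")
    case True
    have "\<exists>w. nonbacktracking adj w \<and> 2 \<le> length w \<and> length w < 2 * length p \<and> hd w = last w
        \<and> set w \<subseteq> set p \<union> set q'"
      by (rule Cons.IH) (use Cons.prems ne q True nonbacktracking_tl in auto)
    then show ?thesis by (fastforce simp: q)
  next
    case False
    have p: "nonbacktracking adj (rev p @ [h])"
      using nonbacktracking_rev[OF assms(1) Cons.prems(1)] by simp
    have q': "nonbacktracking adj (h # q')" using Cons.prems(2) q by simp
    have w: "nonbacktracking adj (rev p @ h # q')"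
      by (rule nonbacktracking_join[OF p q']) (use ne False in \<open>simp_all add: last_rev\<close>)
    have "last p = last q'" using Cons.prems q ne by simp
    with w ne \<open>length p = length q'\<close> q show ?thesis
      by (intro exI[of _ "rev p @ h # q'"]) (simp add: hd_append hd_rev Suc_le_eq)
  qed
qed simp

text \<open>The stretch between two visits of the same vertex would be a shorter closed walk of the
  same kind. No condition is imposed where a closed walk closes up, so the stretch
  qualifies.\<close>

lemma shortest_closed_nonbacktracking_distinct:
  assumes w: "nonbacktracking adj w" "2 \<le> length w" "hd w = last w"
    and shortest: "\<And>v. nonbacktracking adj v \<Longrightarrow> 2 \<le> length v \<Longrightarrow> hd v = last v \<Longrightarrow>
      set v \<subseteq> set w \<Longrightarrow> length w \<le> length v"
  shows "distinct (butlast w)"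
proof (rule ccontr)
  assume "\<not> distinct (butlast w)"
  then obtain xs ys zs x where d: "butlast w = xs @ [x] @ ys @ [x] @ zs"
    using not_distinct_decomp by blast
  have "w = butlast w @ [last w]" using w by (metis append_butlast_last_id list.size(3) not_numeral_le_zero)
  then have w_eq: "w = xs @ (x # ys @ [x]) @ (zs @ [last w])" using d by simp
  then have "nonbacktracking adj (x # ys @ [x])" using w(1) nonbacktracking_append1 nonbacktracking_append2 by metis
  moreover have "set (x # ys @ [x]) \<subseteq> set w" by (subst w_eq) auto
  ultimately have "length w \<le> length (x # ys @ [x])" by (intro shortest) auto
  then show False by (subst (asm) w_eq) simp
qed

definition cycle :: "('a \<Rightarrow> 'a \<Rightarrow> bool) \<Rightarrow> 'a list \<Rightarrow> bool" where
  "cycle adj gs \<longleftrightarrow> distinct gs \<and> 3 \<le> length gs \<and> successively adj gs \<and> adj (last gs) (hd gs)"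

lemma nonbacktracking_successively: "nonbacktracking adj w \<Longrightarrow> successively adj w"
  by (induction adj w rule: nonbacktracking.induct) auto

text \<open>Take a shortest closed walk within the given vertices. Two entries would be a loop and
  three would be a backtrack, so at least three distinct vertices remain after dropping the repeated
  endpoint.\<close>

lemma cycle_of_closed_nonbacktracking:
  assumes adj: "symp adj" "irreflp adj" and w: "nonbacktracking adj w" "2 \<le> length w" "hd w = last w"
  shows "\<exists>gs. cycle adj gs \<and> length gs < length w \<and> set gs \<subseteq> set w"
proof -
  let ?P = "\<lambda>v. nonbacktracking adj v \<and> 2 \<le> length v \<and> hd v = last v \<and> set v \<subseteq> set w"
  define v where "v = arg_min length ?P"
  have v: "?P v" "\<And>u. ?P u \<Longrightarrow> length v \<le> length u"
    unfolding v_def using arg_min_nat_lemma[of ?P w length] w by auto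
  then have dist: "distinct (butlast v)"
    by (intro shortest_closed_nonbacktracking_distinct) (auto intro: v(2))
  have ne: "v \<noteq> []" "butlast v \<noteq> []" using v(1) by (auto simp: length_butlast simp flip: length_0_conv)
  then have v_eq: "v = butlast v @ [last v]" by simp
  have suc: "successively adj (butlast v @ [last v])"
    using v(1) nonbacktracking_successively v_eq by metis
  have hd_eq: "hd (butlast v) = last v" using v(1) v_eq ne by (metis hd_append2)
  have "length v \<noteq> 2"
  proof
    assume "length v = 2"
    then obtain a b where "v = [a, b]" by (auto simp: numeral_eq_Suc length_Suc_conv)
    with v(1) adj(2) show False by (auto dest: irreflpD)
  qed
  moreover have "length v \<noteq> 3"
  proof
    assume "length v = 3"
    then obtain a b c where "v = [a, b, c]" by (auto simp: numeral_eq_Suc length_Suc_conv)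
    with v(1) show False by auto
  qed
  moreover have "2 \<le> length v" using v(1) by blast
  ultimately have "3 \<le> length (butlast v)" unfolding length_butlast by linarith
  moreover have "successively adj (butlast v)" "adj (last (butlast v)) (last v)"
    using suc[unfolded successively_append_iff] ne by simp_all
  ultimately have "cycle adj (butlast v)" using dist hd_eq by (simp add: cycle_def)
  moreover have "length (butlast v) < length w"
  proof -
    have "length v \<le> length w" using w by (intro v(2)) auto
    then show ?thesis using \<open>2 \<le> length v\<close> unfolding length_butlast by linarith
  qed
  moreover have "set (butlast v) \<subseteq> set w" using v(1) by (auto dest: in_set_butlastD)
  ultimately show ?thesis by blast
qed

text \<open>There are at least \<open>2^d\<close> non-backtracking walks with \<open>d\<close> edges ending at a root,
  so two start at the same vertex.\<close>
lemma short_cycle: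
  assumes adj: "symp adj" "irreflp adj" and I: "finite I" "I \<noteq> {}" "card I < 2 ^ d"
    and deg: "\<And>g. g \<in> I \<Longrightarrow> 3 \<le> card {h \<in> I. adj g h}"
  shows "\<exists>gs. cycle adj gs \<and> length gs \<le> 2 * d \<and> set gs \<subseteq> I"
proof -
  obtain r where r: "r \<in> I" using I by blast
  define W where "W k = {w. nonbacktracking adj w \<and> length w = Suc k \<and> set w \<subseteq> I \<and> last w = r}" for k
  have finW: "finite (W k)" for k
    by (rule finite_subset[OF _ finite_lists_length_eq[OF I(1), of "Suc k"]]) (auto simp: W_def)
  have card_W: "2 ^ k \<le> card (W k)" for k
  proof (induction k)
    case 0
    have "[r] \<in> W 0" using r by (simp add: W_def)
    then show ?case using finW[of 0] by (metis One_nat_def Suc_leI card_gt_0_iff empty_iff power_0)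
  next
    case (Suc k)
    define ext where "ext w = {h \<in> I. adj (hd w) h \<and> (tl w \<noteq> [] \<longrightarrow> h \<noteq> hd (tl w))}" for w
    have ext: "2 \<le> card (ext w)" if "w \<in> W k" for w
    proof -
      have "hd w \<in> I" using that by (cases w) (auto simp: W_def)
      then have "3 \<le> card {h \<in> I. adj (hd w) h}" by (rule deg)
      \<comment> \<open>Of at least three neighbours only the vertex just left is forbidden. For a
        one-vertex walk \<open>hd (tl w)\<close> is an unspecified value, which is harmless in an
        upper bound.\<close>
      moreover have "card {h \<in> I. adj (hd w) h} \<le> card (insert (hd (tl w)) (ext w))"
        using I(1) by (intro card_mono) (auto simp: ext_def)
      moreover have "card (insert (hd (tl w)) (ext w)) \<le> Suc (card (ext w))"
        by (rule card_insert_le_m1) auto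
      ultimately show ?thesis by linarith
    qed
    have sub: "(\<lambda>(w, h). h # w) ` (SIGMA w:W k. ext w) \<subseteq> W (Suc k)"
    proof clarify
      fix w h assume wh: "w \<in> W k" "h \<in> ext w"
      then obtain g w' where "w = g # w'" by (cases w) (auto simp: W_def)
      with wh adj(1) show "h # w \<in> W (Suc k)"
        by (auto simp: W_def ext_def nonbacktracking_Cons dest: sympD)
    qed
    have "inj_on (\<lambda>(w, h). h # w) (SIGMA w:W k. ext w)" by (auto simp: inj_on_def)
    then have "card (SIGMA w:W k. ext w) \<le> card (W (Suc k))"
      using card_inj_on_le[OF _ sub finW] by blast
    moreover have "card (SIGMA w:W k. ext w) = (\<Sum>w\<in>W k. card (ext w))"
      using finW I(1) by (intro card_SigmaI) (auto simp: ext_def)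
    moreover have "(\<Sum>w\<in>W k. 2) \<le> (\<Sum>w\<in>W k. card (ext w))" by (rule sum_mono) (rule ext)
    ultimately show ?case using Suc.IH by simp
  qed
  have "hd ` W d \<subseteq> I"
  proof clarify
    fix w assume "w \<in> W d"
    then show "hd w \<in> I" by (cases w) (auto simp: W_def)
  qed
  then have "card (hd ` W d) \<le> card I" using I(1) by (rule card_mono[rotated])
  then have "card (hd ` W d) < card (W d)" using I(3) card_W[of d] by linarith
  then have "\<not> inj_on hd (W d)" by (rule pigeonhole)
  then obtain p q where pq: "p \<in> W d" "q \<in> W d" "hd p = hd q" "p \<noteq> q" by (auto simp: inj_on_def)
  then obtain w where w: "nonbacktracking adj w" "2 \<le> length w" "length w < 2 * length p"
    "hd w = last w" "set w \<subseteq> set p \<union> set q"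
    using closed_nonbacktracking[OF adj(1), of p q] by (auto simp: W_def)
  from cycle_of_closed_nonbacktracking[OF adj w(1,2,4)] obtain gs
    where gs: "cycle adj gs" "length gs < length w" "set gs \<subseteq> set w" by blast
  \<comment> \<open>The walks have \<open>d + 1\<close> vertices, so \<open>w\<close> has at most
    \<open>2 * d + 1\<close> entries, and the cycle is shorter than \<open>w\<close>.\<close>
  have "length gs \<le> 2 * d" using gs(2) w(3) pq(1) by (simp add: W_def)
  moreover have "set p \<subseteq> I" "set q \<subseteq> I" using pq(1,2) by (simp_all add: W_def)
  then have "set gs \<subseteq> I" using gs(3) w(5) by blast
  ultimately show ?thesis using gs(1) by blast
qed

subsection \<open>Networks of parity gates\<close>

definition net_cnf :: "'i set \<Rightarrow> ('i \<Rightarrow> 'v set) \<Rightarrow> ('i \<Rightarrow> bool) \<Rightarrow> 'v cnf" where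
  "net_cnf I V c = (\<Union>i\<in>I. gate (V i) (c i))"

text \<open>Gates are indexed rather than collected in a set: two gates with equal variables and
  charge must count as two occurrences and contribute twice to the total charge. Arity below three
  is allowed because contraction can lower it.\<close>

definition parity_net :: "'v set \<Rightarrow> 'i set \<Rightarrow> ('i \<Rightarrow> 'v set) \<Rightarrow> ('i \<Rightarrow> bool) \<Rightarrow> bool" where
  "parity_net X I V c \<longleftrightarrow> finite I \<and>
     (\<forall>i\<in>I. V i \<subseteq> X \<and> finite (V i) \<and> card (V i) \<le> 3) \<and>
     (\<forall>i\<in>I. \<forall>v\<in>V i. card {k \<in> I. v \<in> V k} = 2) \<and> par c I"

lemma parity_netD:
  assumes "parity_net X I V c"
  shows "finite I" "par c I" "i \<in> I \<Longrightarrow> V i \<subseteq> X" "i \<in> I \<Longrightarrow> finite (V i)" "i \<in> I \<Longrightarrow> card (V i) \<le> 3"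
    "i \<in> I \<Longrightarrow> v \<in> V i \<Longrightarrow> card {k \<in> I. v \<in> V k} = 2"
  using assms by (simp_all add: parity_net_def)

lemma parity_net_occurrences:
  assumes net: "parity_net X I V c" and ij: "i \<in> I" "j \<in> I" "i \<noteq> j" and v: "v \<in> V i" "v \<in> V j"
  shows "{k \<in> I. v \<in> V k} = {i, j}"
proof -
  have "{i, j} = {k \<in> I. v \<in> V k}"
    by (rule card_subset_eq) (use assms parity_netD(1)[OF net] parity_netD(6)[OF net, of i v] in auto)
  then show ?thesis by simp
qed

lemma net_cnf_split:
  assumes "i \<in> I" "j \<in> I"
  shows "net_cnf I V c = net_cnf (I - {i, j}) V c \<union> gate (V i) (c i) \<union> gate (V j) (c j)"
  using assms by (auto simp: net_cnf_def)

text \<open>The side conditions of the RAT steps: the two permitted occurrences of \<open>t\<close>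
  are used up by \<open>i\<close> and \<open>j\<close>, so the remaining gates do not mention
  it.\<close>

lemma net_cnf_rest:
  assumes net: "parity_net X I V c" and ij: "i \<in> I" "j \<in> I" "i \<noteq> j" and t: "t \<in> V i" "t \<in> V j"
  shows "t \<notin> vars (net_cnf (I - {i, j}) V c)" "D \<in> net_cnf (I - {i, j}) V c \<Longrightarrow> finite D"
proof -
  have "t \<notin> var ` D" if D: "D \<in> gate (V k) (c k)" and k: "k \<in> I - {i, j}" for k D
  proof -
    have "k \<notin> {m \<in> I. t \<in> V m}" using parity_net_occurrences[OF net ij t] k by blast
    with k show ?thesis unfolding var_gate[OF D] by blast
  qed
  then show "t \<notin> vars (net_cnf (I - {i, j}) V c)" by (auto simp: vars_def net_cnf_def image_Union)
  assume "D \<in> net_cnf (I - {i, j}) V c"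
  then obtain k where "k \<in> I" "D \<in> gate (V k) (c k)" by (auto simp: net_cnf_def)
  then show "finite D" using finite_in_gate parity_netD(4)[OF net] by blast
qed

text \<open>Index \<open>i\<close> takes over the sum and \<open>j\<close> disappears. Variables
  shared by both gates vanish altogether, those of \<open>V j\<close> alone move to
  \<open>i\<close>, and the charges add up, so the invariant survives.\<close>

lemma parity_net_contract:
  assumes net: "parity_net X I V c" and ij: "i \<in> I" "j \<in> I" "i \<noteq> j" and t: "t \<in> V i" "t \<in> V j"
    and card: "card (sym_diff (V i) (V j)) \<le> 3"
  defines "V' \<equiv> V(i := sym_diff (V i) (V j))" and "c' \<equiv> c(i := (c i \<noteq> c j))"
  shows "parity_net X (I - {j}) V' c'"
    and "reach X (net_cnf I V c) 2064 (net_cnf (I - {j}) V' c')"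
proof -
  note netD = parity_netD[OF net]
  show "parity_net X (I - {j}) V' c'"
    unfolding parity_net_def
  proof (intro conjI ballI)
    show "finite (I - {j})" using netD(1) by simp
    fix k assume k: "k \<in> I - {j}"
    have "V' k \<subseteq> X \<and> finite (V' k) \<and> card (V' k) \<le> 3"
    proof (cases "k = i")
      case True
      then show ?thesis using netD(3,4)[OF ij(1)] netD(3,4)[OF ij(2)] card by (auto simp: V'_def)
    next
      case False
      then show ?thesis using netD(3-5)[of k] k by (simp add: V'_def)
    qed
    then show "V' k \<subseteq> X" "finite (V' k)" "card (V' k) \<le> 3" by blast+
    fix v assume v: "v \<in> V' k"
    \<comment> \<open>A surviving variable cannot have been in both gates, since it would then occur
      nowhere else.\<close>
    have not_both: "v \<notin> V i \<or> v \<notin> V j"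
    proof (rule ccontr)
      assume "\<not> ?thesis"
      then have vij: "v \<in> V i" "v \<in> V j" by auto
      then have "k \<noteq> i" using v by (auto simp: V'_def)
      then have "k \<in> {m \<in> I. v \<in> V m}" using v k by (simp add: V'_def)
      then show False
        unfolding parity_net_occurrences[OF net ij vij] using k \<open>k \<noteq> i\<close> by simp
    qed
    let ?S = "{m \<in> I. v \<in> V m}"
    have finS: "finite ?S" using netD(1) by simp
    show "card {m \<in> I - {j}. v \<in> V' m} = 2"
    proof (cases "v \<in> V j")
      case True
      then have "card ?S = 2" using netD(6)[OF ij(2)] by simp
      moreover have "{m \<in> I - {j}. v \<in> V' m} = insert i (?S - {j})"
        using True not_both ij by (auto simp: V'_def)
      moreover have "i \<notin> ?S - {j}" "j \<in> ?S" using True not_both ij by auto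
      ultimately show ?thesis using finS by simp
    next
      case False
      then have "{m \<in> I - {j}. v \<in> V' m} = ?S" using ij by (auto simp: V'_def)
      moreover have "v \<in> V k" using v False by (auto simp: V'_def split: if_splits)
      ultimately show ?thesis using netD(6)[of k v] k by simp
    qed
  next
    let ?R = "I - {i, j}"
    have I: "I = insert i (insert j ?R)" "I - {j} = insert i ?R" using ij by auto
    have fin: "finite ?R" using netD(1) by simp
    have "par c I \<longleftrightarrow> c i \<noteq> (c j \<noteq> par c ?R)"
      using ij fin by (subst I(1)) (simp add: par_insert)
    moreover have "par c' (I - {j}) \<longleftrightarrow> c' i \<noteq> par c' ?R"
      using fin by (subst I(2)) (simp add: par_insert)
    moreover have "par c' ?R = par c ?R" by (rule par_cong) (simp add: c'_def)
    moreover have "c' i = (c i \<noteq> c j)" by (simp add: c'_def)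
    ultimately show "par c' (I - {j})" using netD(2) by (cases "c i"; cases "c j"; simp)
  qed
  let ?F = "net_cnf (I - {i, j}) V c"
  have "reach X (?F \<union> gate (V i) (c i) \<union> gate (V j) (c j)) 2064 (?F \<union> gate_sum (V i) (c i) (V j) (c j))"
    using netD(4)[OF ij(1)] netD(4)[OF ij(2)] net_cnf_rest(2)[OF net ij t]
      netD(5)[OF ij(1)] netD(5)[OF ij(2)] card netD(3)[OF ij(1)] netD(3)[OF ij(2)] t net_cnf_rest(1)[OF net ij t]
    by (intro reach_contract[where t = t]) simp_all
  moreover have "net_cnf (I - {j}) V' c' = ?F \<union> gate_sum (V i) (c i) (V j) (c j)"
  proof -
    have I: "I - {j} = insert i (I - {i, j})" using ij by auto
    have "net_cnf (I - {i, j}) V' c' = ?F" by (simp add: net_cnf_def V'_def c'_def)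
    then show ?thesis unfolding I net_cnf_def by (simp add: V'_def c'_def Un_commute)
  qed
  ultimately show "reach X (net_cnf I V c) 2064 (net_cnf (I - {j}) V' c')"
    using net_cnf_split[OF ij(1,2), of V c] by simp
qed

text \<open>Trading \<open>b\<close> for \<open>e\<close> leaves \<open>t\<close> shared and keeps
  the sum and both charges. Occurrence counts stay at two because \<open>b\<close> and
  \<open>e\<close> merely change sides.\<close>

lemma parity_net_exchange:
  assumes net: "parity_net X I V c" and ij: "i \<in> I" "j \<in> I" "i \<noteq> j" and t: "V i \<inter> V j = {t}"
    and b: "b \<in> V i" "b \<noteq> t" and e: "e \<in> V j" "e \<noteq> t"
  defines "V' \<equiv> V(i := insert e (V i - {b}), j := insert b (V j - {e}))"
  shows "parity_net X I V' c" and "reach X (net_cnf I V c) 4096 (net_cnf I V' c)"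
proof -
  note netD = parity_netD[OF net]
  have be: "b \<notin> V j" "e \<notin> V i" "b \<noteq> e" using t b e by auto
  have Vij: "V' i = insert e (V i - {b})" "V' j = insert b (V j - {e})" using ij by (auto simp: V'_def)
  have V'_other: "V' k = V k" if "k \<noteq> i" "k \<noteq> j" for k using that by (simp add: V'_def)
  have fin: "finite (V i)" "finite (V j)" using netD(4) ij by blast+
  have "card (V' i) = card (V i)" "card (V' j) = card (V j)"
    unfolding Vij using be fin card_Suc_Diff1[OF fin(1) b(1)] card_Suc_Diff1[OF fin(2) e(1)] by simp_all
  then have card': "card (V' i) \<le> 3" "card (V' j) \<le> 3" using netD(5) ij by auto
  have sub': "V' i \<subseteq> X" "V' j \<subseteq> X"
    unfolding Vij using netD(3)[OF ij(1)] netD(3)[OF ij(2)] b e by auto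
  show "parity_net X I V' c"
    unfolding parity_net_def
  proof (intro conjI ballI)
    show "finite I" "par c I" using netD(1,2) by auto
    fix k assume k: "k \<in> I"
    have "V' k \<subseteq> X \<and> finite (V' k) \<and> card (V' k) \<le> 3"
    proof (cases "k = i \<or> k = j")
      case True
      then show ?thesis using sub' card' fin Vij by auto
    next
      case False
      then show ?thesis using netD(3-5)[OF k] V'_other[of k] by simp
    qed
    then show "V' k \<subseteq> X" "finite (V' k)" "card (V' k) \<le> 3" by blast+
    fix v assume v: "v \<in> V' k"
    let ?S = "{m \<in> I. v \<in> V m}"
    have finS: "finite ?S" using netD(1) by simp
    consider "v = b" | "v = e" | "v \<noteq> b" "v \<noteq> e" by blast
    then show "card {m \<in> I. v \<in> V' m} = 2"
    proof cases
      case 1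
      then have "card ?S = 2" using netD(6)[OF ij(1)] b by simp
      moreover have "{m \<in> I. v \<in> V' m} = insert j (?S - {i})"
        using 1 ij b be by (auto simp: V'_def)
      moreover have "j \<notin> ?S - {i}" "i \<in> ?S" using 1 be ij b by auto
      ultimately show ?thesis using finS by simp
    next
      case 2
      then have "card ?S = 2" using netD(6)[OF ij(2)] e by simp
      moreover have "{m \<in> I. v \<in> V' m} = insert i (?S - {j})"
        using 2 ij e be by (auto simp: V'_def)
      moreover have "i \<notin> ?S - {j}" "j \<in> ?S" using 2 be ij e by auto
      ultimately show ?thesis using finS by simp
    next
      case 3
      then have V'_iff: "v \<in> V' m \<longleftrightarrow> v \<in> V m" for m by (auto simp: V'_def)
      then show ?thesis using netD(6)[OF k] v by simp
    qed
  qed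
  let ?F = "net_cnf (I - {i, j}) V c"
  have tij: "t \<in> V i" "t \<in> V j" using t by auto
  have "reach X (?F \<union> gate (V i) (c i) \<union> gate (V j) (c j)) 4096
      (?F \<union> gate (V' i) (c i) \<union> gate (V' j) (c j))"
  proof (rule reach_exchange[where t = t])
    show "V' i \<inter> V' j = {t}" unfolding Vij using t b e be by auto
    show "sym_diff (V' i) (V' j) = sym_diff (V i) (V j)" unfolding Vij using b e be by auto
    show "finite (V' i)" "finite (V' j)" unfolding Vij using fin by auto
    show "card (V i) \<le> 3" "card (V j) \<le> 3" using netD(5) ij by auto
    show "V i \<union> V j \<subseteq> X" using netD(3) ij by blast
    show "finite D" if "D \<in> ?F" for D using net_cnf_rest(2)[OF net ij tij that] .
  qed (fact fin card' t net_cnf_rest(1)[OF net ij tij])+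
  moreover have "net_cnf (I - {i, j}) V' c = ?F" by (simp add: net_cnf_def V'_def)
  ultimately show "reach X (net_cnf I V c) 4096 (net_cnf I V' c)"
    using net_cnf_split[OF ij(1,2), of V c] net_cnf_split[OF ij(1,2), of V' c] by simp
qed

section \<open>From short cycles to contractible pairs\<close>

definition contractible :: "'i set \<Rightarrow> ('i \<Rightarrow> 'v set) \<Rightarrow> bool" where
  "contractible I V \<longleftrightarrow>
     (\<exists>i\<in>I. \<exists>j\<in>I. i \<noteq> j \<and> V i \<inter> V j \<noteq> {} \<and> card (sym_diff (V i) (V j)) \<le> 3)"

lemma card_sym_diff:
  assumes "finite A" "finite B"
  shows "card (sym_diff A B) + 2 * card (A \<inter> B) = card A + card B"
proof -
  have "card (sym_diff A B) = card (A - B) + card (B - A)"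
    using assms by (intro card_Un_disjoint) auto
  moreover have "card A = card (A \<inter> B) + card (A - B)" "card B = card (A \<inter> B) + card (B - A)"
    using card_Int_Diff[OF assms(1), of B] card_Int_Diff[OF assms(2), of A] by (simp_all add: Int_commute)
  ultimately show ?thesis by linarith
qed

text \<open>A sum has \<open>card (V i) + card (V j) - 2 * card (V i \<inter> V j)\<close>
  variables. With arities at most 3 and a nonempty intersection, reaching 4 forces
  \<open>3 + 3 - 2\<close>. So pairs that resist contraction are ternary gates joined by a simple
  edge.\<close>

lemma not_contractible:
  assumes net: "parity_net X I V c" and nc: "\<not> contractible I V"
    and ij: "i \<in> I" "j \<in> I" "i \<noteq> j" "V i \<inter> V j \<noteq> {}"
  shows "card (V i) = 3" "card (V i \<inter> V j) = 1"
proof -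
  note netD = parity_netD[OF net]
  have fin: "finite (V i)" "finite (V j)" using netD(4) ij by blast+
  have "card (V i) \<le> 3" "card (V j) \<le> 3" using netD(5) ij by blast+
  moreover have "\<not> card (sym_diff (V i) (V j)) \<le> 3" using nc ij unfolding contractible_def by blast
  moreover have "card (V i \<inter> V j) > 0" using ij(4) fin by (simp add: card_gt_0_iff)
  ultimately show "card (V i) = 3" "card (V i \<inter> V j) = 1"
    using card_sym_diff[OF fin] by linarith+
qed

definition gate_adj :: "('i \<Rightarrow> 'v set) \<Rightarrow> 'i \<Rightarrow> 'i \<Rightarrow> bool" where
  "gate_adj V g h \<longleftrightarrow> g \<noteq> h \<and> V g \<inter> V h \<noteq> {}"

text \<open>An exchange along the edge between the first two gates of a cycle takes the second gate out of it.\<close>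
lemma shorten_cycle:
  assumes "parity_net X I V c" "cycle (gate_adj V) gs" "set gs \<subseteq> I"
  shows "\<exists>V'. parity_net X I V' c \<and> contractible I V' \<and>
    reach X (net_cnf I V c) (4096 * length gs) (net_cnf I V' c)"
  using assms
proof (induction "length gs" arbitrary: gs V rule: less_induct)
  case less
  note net = less.prems(1)
  show ?case
  proof (cases "contractible I V")
    case True
    with net show ?thesis using reach_refl by blast
  next
    case False
    have "3 \<le> length gs" using less.prems(2) by (simp add: cycle_def)
    then obtain g0 g1 g2 rest where gs: "gs = g0 # g1 # g2 # rest"
      by (auto simp: numeral_eq_Suc Suc_le_length_iff)
    define l where "l = last (g2 # rest)"
    have l: "l \<in> set (g2 # rest)" unfolding l_def by (rule last_in_set) simp
    have dist: "g0 \<noteq> g1" "g0 \<notin> set (g2 # rest)" "g1 \<notin> set (g2 # rest)" "distinct (g2 # rest)"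
      using less.prems(2) by (auto simp: gs cycle_def)
    have inI: "g0 \<in> I" "g1 \<in> I" "g2 \<in> I" "l \<in> I" using less.prems(3) l by (auto simp: gs)
    have adj: "V g0 \<inter> V g1 \<noteq> {}" "V g1 \<inter> V g2 \<noteq> {}" "V l \<inter> V g0 \<noteq> {}"
      and suc: "successively (gate_adj V) (g2 # rest)"
      using less.prems(2) by (auto simp: gs cycle_def gate_adj_def l_def split: if_splits)
    from not_contractible[OF net False inI(1,2) dist(1) adj(1)]
    have card: "card (V g0) = 3" "card (V g0 \<inter> V g1) = 1" by auto
    then obtain t where t: "V g0 \<inter> V g1 = {t}" by (auto simp: card_1_singleton_iff)
    then have occ: "{k \<in> I. t \<in> V k} = {g0, g1}"
      using parity_net_occurrences[OF net inI(1,2) dist(1), of t] by blast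
    obtain a where a: "a \<in> V l" "a \<in> V g0" using adj(3) by blast
    obtain e where e: "e \<in> V g1" "e \<in> V g2" using adj(2) by blast
    \<comment> \<open>\<open>t\<close> already has its two occurrences at \<open>g0\<close> and
      \<open>g1\<close>, so the cycle leaves \<open>g0\<close> and \<open>g1\<close> through other
      variables.\<close>
    have "t \<notin> V l" "t \<notin> V g2" using occ inI l dist by auto
    with a e have at: "a \<noteq> t" and et: "e \<noteq> t" by auto
    have "\<not> V g0 \<subseteq> {a, t}"
    proof
      assume "V g0 \<subseteq> {a, t}"
      then have "card (V g0) \<le> card {a, t}" by (rule card_mono[rotated]) simp
      with card(1) at show False by simp
    qed
    \<comment> \<open>At \<open>g0\<close>, \<open>t\<close> leads to \<open>g1\<close>,
      \<open>a\<close> to the last gate \<open>l\<close>, and \<open>b\<close> is the third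
      variable. Giving \<open>b\<close> to \<open>g1\<close> in return for \<open>e\<close> joins
      \<open>g0\<close> directly to \<open>g2\<close>.\<close>
    then obtain b where b: "b \<in> V g0" "b \<noteq> a" "b \<noteq> t" by blast
    define V' where "V' = V(g0 := insert e (V g0 - {b}), g1 := insert b (V g1 - {e}))"
    from parity_net_exchange[OF net inI(1,2) dist(1) t b(1,3) e(1) et]
    have net': "parity_net X I V' c" and r: "reach X (net_cnf I V c) 4096 (net_cnf I V' c)"
      unfolding V'_def by auto
    have V'0: "a \<in> V' g0" "e \<in> V' g0" using dist a(2) b by (auto simp: V'_def)
    have V'_other: "V' g = V g" if "g \<in> set (g2 # rest)" for g
      using that dist by (auto simp: V'_def)
    have "e \<notin> V g0" using t e et by blast
    with a have ae: "a \<noteq> e" by blast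
    show ?thesis
    \<comment> \<open>In a triangle \<open>l\<close> is \<open>g2\<close>, so the exchange makes
      \<open>g0\<close> and \<open>g2\<close> share both \<open>a\<close> and \<open>e\<close>; such
      a pair is contractible.\<close>
    proof (cases "rest = []")
      case True
      then have "l = g2" by (simp add: l_def)
      with V'0 V'_other[of g2] a e have ae_in: "{a, e} \<subseteq> V' g0 \<inter> V' g2" by simp
      have fin: "finite (V' g0)" "finite (V' g2)" and le: "card (V' g0) \<le> 3" "card (V' g2) \<le> 3"
        using parity_netD(4,5)[OF net'] inI by blast+
      have "card {a, e} \<le> card (V' g0 \<inter> V' g2)" using fin ae_in by (intro card_mono) auto
      with ae have "2 \<le> card (V' g0 \<inter> V' g2)" by simp
      with card_sym_diff[OF fin] le have "card (sym_diff (V' g0) (V' g2)) \<le> 3" by linarith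
      moreover have "g0 \<noteq> g2" "V' g0 \<inter> V' g2 \<noteq> {}" using dist ae_in by auto
      ultimately have "contractible I V'" using inI unfolding contractible_def by blast
      with net' r show ?thesis by (intro exI[of _ V']) (auto simp: gs elim: reach_mono)
    next
      case False
      have "successively (gate_adj V') (g2 # rest)"
        using suc by (rule successively_cong[THEN iffD1, rotated -1])
          (use V'_other in \<open>auto simp: gate_adj_def\<close>)
      moreover have "gate_adj V' g0 g2" using dist V'0 V'_other[of g2] e by (auto simp: gate_adj_def)
      moreover have "gate_adj V' l g0" using l dist V'0 V'_other[OF l] a by (auto simp: gate_adj_def)
      moreover have "length rest \<ge> 1" using False by (simp add: Suc_le_eq)
      ultimately have cyc: "cycle (gate_adj V') (g0 # g2 # rest)"
        using dist False by (auto simp: cycle_def l_def)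
      have "length (g0 # g2 # rest) < length gs" "set (g0 # g2 # rest) \<subseteq> I"
        using less.prems(3) by (auto simp: gs)
      from less.hyps[OF this(1) net' cyc this(2)] obtain V'' where V'': "parity_net X I V'' c"
        "contractible I V''" "reach X (net_cnf I V' c) (4096 * length (g0 # g2 # rest)) (net_cnf I V'' c)"
        by blast
      from reach_trans[OF r V''(3)] have "reach X (net_cnf I V c) (4096 * length gs) (net_cnf I V'' c)"
        by (simp add: gs)
      with V'' show ?thesis by blast
    qed
  qed
qed

text \<open>Without a contractible pair each gate has three variables leading to three different
  neighbours, because two variables to the same neighbour would be a contractible double edge. The
  degree bound thus holds, and a cycle of at most \<open>2 * d\<close> gates costs
  \<open>4096 * (2 * d)\<close> lines.\<close>

lemma reach_contractible:
  assumes net: "parity_net X I V c" and ne: "\<And>i. i \<in> I \<Longrightarrow> V i \<noteq> {}" and I: "card I < 2 ^ d"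
  shows "\<exists>V'. parity_net X I V' c \<and> contractible I V' \<and>
    reach X (net_cnf I V c) (8192 * d) (net_cnf I V' c)"
proof (cases "contractible I V")
  case True
  with net show ?thesis using reach_refl by blast
next
  case False
  note netD = parity_netD[OF net]
  have other: "\<exists>h. h \<in> I \<and> h \<noteq> g \<and> v \<in> V h" if g: "g \<in> I" and v: "v \<in> V g" for g v
  proof (rule ccontr)
    assume "\<nexists>h. h \<in> I \<and> h \<noteq> g \<and> v \<in> V h"
    then have "{k \<in> I. v \<in> V k} = {g}" using g v by blast
    with netD(6)[OF g v] show False by simp
  qed
  have deg: "3 \<le> card {h \<in> I. gate_adj V g h}" if g: "g \<in> I" for g
  proof -
    obtain f where f: "\<And>v. v \<in> V g \<Longrightarrow> f v \<in> I \<and> f v \<noteq> g \<and> v \<in> V (f v)"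
      using other[OF g] by metis
    have sub: "f ` V g \<subseteq> {h \<in> I. gate_adj V g h}" using f by (fastforce simp: gate_adj_def)
    have "inj_on f (V g)"
    proof (rule inj_onI)
      fix v w assume vw: "v \<in> V g" "w \<in> V g" "f v = f w"
      then have vw_in: "v \<in> V g \<inter> V (f v)" "w \<in> V g \<inter> V (f v)" using f[of v] f[of w] by auto
      have "card (V g \<inter> V (f v)) = 1"
        using not_contractible(2)[OF net False g, of "f v"] f[OF vw(1)] vw_in by auto
      then obtain x where "V g \<inter> V (f v) = {x}" by (auto simp: card_1_singleton_iff)
      then show "v = w" using vw_in by (metis singletonD)
    qed
    then have "card (V g) \<le> card {h \<in> I. gate_adj V g h}"
      using sub netD(1) by (intro card_inj_on_le) auto
    moreover obtain v where "v \<in> V g" using ne[OF g] by blast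
    then have "card (V g) = 3"
      using not_contractible(1)[OF net False g, of "f v"] f[of v] by blast
    ultimately show ?thesis by simp
  qed
  have "I \<noteq> {}" using netD(2) by auto
  with deg netD(1) I obtain gs where gs: "cycle (gate_adj V) gs" "length gs \<le> 2 * d" "set gs \<subseteq> I"
    using short_cycle[of "gate_adj V" I d] by (auto simp: gate_adj_def symp_def irreflp_def Int_commute)
  from shorten_cycle[OF net gs(1,3)] obtain V' where "parity_net X I V' c" "contractible I V'"
    "reach X (net_cnf I V c) (4096 * length gs) (net_cnf I V' c)" by blast
  moreover have "4096 * length gs \<le> 8192 * d" using gs(2) by simp
  ultimately show ?thesis using reach_mono by blast
qed

text \<open>Each round removes one gate, with \<open>d\<close> fixed while the network shrinks. The
  gates cannot run out before a contradiction is found, because an empty network has even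
  charge.\<close>

lemma parity_net_refutable:
  assumes "parity_net X I V c" "card I < 2 ^ d"
  shows "\<exists>G. reach X (net_cnf I V c) (card I * (8192 * d + 2064)) G \<and> {} \<in> G"
  using assms
proof (induction "card I" arbitrary: I V c)
  case 0
  then have "I = {}" using parity_netD(1) by force
  with parity_netD(2)[OF 0(2)] show ?case by simp
next
  case (Suc n)
  note netD = parity_netD[OF Suc.prems(1)]
  show ?case
  proof (cases "\<exists>i\<in>I. V i = {}")
    case True
    then obtain i where i: "i \<in> I" "V i = {}" by blast
    show ?thesis
    \<comment> \<open>An empty gate of charge \<open>True\<close> is the clause sought. One of
      charge \<open>False\<close> contributes no clause, so dropping its index changes neither the
      formula nor the total charge.\<close>
    proof (cases "c i")
      case True
      with i(2) have "{} \<in> gate (V i) (c i)" by (simp add: gate_empty)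
      with i(1) have "{} \<in> net_cnf I V c" unfolding net_cnf_def by blast
      then show ?thesis using reach_refl by blast
    next
      case False
      have I: "I = insert i (I - {i})" using i by blast
      have card: "card (I - {i}) = n" using i Suc.hyps(2) netD(1) by simp
      have "par c I \<longleftrightarrow> c i \<noteq> par c (I - {i})"
        using netD(1) by (subst I, subst par_insert) auto
      moreover have "{k \<in> I - {i}. v \<in> V k} = {k \<in> I. v \<in> V k}" for v using i by auto
      ultimately have "parity_net X (I - {i}) V c"
        using Suc.prems(1) False unfolding parity_net_def by auto
      moreover have "card (I - {i}) < 2 ^ d" using card Suc.hyps(2) Suc.prems(2) by simp
      ultimately obtain G where G: "reach X (net_cnf (I - {i}) V c) (n * (8192 * d + 2064)) G" "{} \<in> G"
        using Suc.hyps(1)[of "I - {i}" V c] card by auto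
      have eq: "net_cnf (I - {i}) V c = net_cnf I V c"
      proof -
        have "net_cnf I V c = gate (V i) (c i) \<union> net_cnf (I - {i}) V c"
          using i(1) unfolding net_cnf_def by blast
        then show ?thesis using i(2) False by (simp add: gate_empty)
      qed
      have "n * (8192 * d + 2064) \<le> card I * (8192 * d + 2064)"
        unfolding Suc.hyps(2)[symmetric] by simp
      from reach_mono[OF G(1)[unfolded eq] this] G(2) show ?thesis by blast
    qed
  next
    case False
    with reach_contractible[OF Suc.prems(1) _ Suc.prems(2)] obtain V' where
      net': "parity_net X I V' c" "contractible I V'" and r1: "reach X (net_cnf I V c) (8192 * d) (net_cnf I V' c)"
      by blast
    from net'(2) obtain i j t where ij: "i \<in> I" "j \<in> I" "i \<noteq> j" "t \<in> V' i" "t \<in> V' j"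
      "card (sym_diff (V' i) (V' j)) \<le> 3" unfolding contractible_def by blast
    from parity_net_contract[OF net'(1) ij] obtain V'' c'' where
      net'': "parity_net X (I - {j}) V'' c''" and
      r2: "reach X (net_cnf I V' c) 2064 (net_cnf (I - {j}) V'' c'')" by blast
    have card: "card (I - {j}) = n" using ij Suc.hyps(2) netD(1) by simp
    moreover have "card (I - {j}) < 2 ^ d" using card Suc.hyps(2) Suc.prems(2) by simp
    ultimately obtain G where G: "{} \<in> G"
      and r3: "reach X (net_cnf (I - {j}) V'' c'') (n * (8192 * d + 2064)) G"
      using Suc.hyps(1)[of "I - {j}" V'' c''] net'' by auto
    from reach_trans[OF reach_trans[OF r1 r2] r3]
    have "reach X (net_cnf I V c) (card I * (8192 * d + 2064)) G"
      unfolding Suc.hyps(2)[symmetric] by simp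
    with G show ?thesis by blast
  qed
qed

subsection \<open>Linear encodings\<close>

text \<open>\<open>Z\<close> collects the negated variables: it is empty for the two given
  constraints and \<open>{z}\<close> for their altered sum, so one translation serves all
  three.\<close>

definition lit_of :: "'v set \<Rightarrow> 'v \<Rightarrow> 'v lit" where
  "lit_of Z v = (if v \<in> Z then Neg v else Pos v)"

lemma par_neq: "finite V \<Longrightarrow> par (\<lambda>v. P v \<noteq> Q v) V \<longleftrightarrow> par P V \<noteq> par Q V"
proof (induction V rule: finite_induct)
  case (insert v V)
  then show ?case by (cases "P v"; cases "Q v") (simp_all add: par_insert)
qed simp

lemma par_eq_singleton: "par (\<lambda>v. v = z) V \<longleftrightarrow> z \<in> V"
proof -
  have "{v \<in> V. v = z} = (if z \<in> V then {z} else {})" by auto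
  then show ?thesis by (simp add: par_def)
qed

text \<open>Each negated literal flips the parity of the true literals against that of the true
  variables, so the charge is the parity of the number of negations.\<close>

lemma xor_cnf_eq_gate:
  assumes "distinct vs"
  shows "xor_cnf (map (lit_of Z) vs) = gate (set vs) (par (\<lambda>v. v \<in> Z) (set vs))"
proof -
  let ?n = "length vs" and ?ys = "map (lit_of Z) vs"
  define clause where "clause N = (\<lambda>i. if i \<in> N then neg (?ys ! i) else ?ys ! i) ` {..<?n}" for N
  \<comment> \<open>The assignment making exactly the literals at positions in \<open>N\<close>
    true, which is the one excluded by \<open>clause N\<close>.\<close>
  define asg where "asg N = (\<lambda>v. (v \<in> (!) vs ` N) \<noteq> (v \<in> Z))" for N
  have vs_set: "set vs = (!) vs ` {..<?n}" by (auto simp: set_conv_nth)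
  have nth_in: "vs ! i \<in> (!) vs ` N \<longleftrightarrow> i \<in> N" if "i < ?n" "N \<subseteq> {..<?n}" for i N
    using that assms by (auto simp: nth_eq_iff_index_eq subset_eq)
  have clause: "clause N = falsified (asg N) (set vs)" if "N \<subseteq> {..<?n}" for N
    unfolding clause_def falsified_def vs_set image_image
    by (intro image_cong refl) (use that in \<open>simp add: asg_def nth_in lit_of_def\<close>)
  have par_asg: "par (asg N) (set vs) \<longleftrightarrow> odd (card N) \<noteq> par (\<lambda>v. v \<in> Z) (set vs)"
    if N: "N \<subseteq> {..<?n}" for N
  proof -
    have "{v \<in> set vs. v \<in> (!) vs ` N} = (!) vs ` N" using N by (auto simp: vs_set)
    moreover have "inj_on ((!) vs) N" using N assms by (auto simp: inj_on_def nth_eq_iff_index_eq subset_eq)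
    ultimately have "par (\<lambda>v. v \<in> (!) vs ` N) (set vs) \<longleftrightarrow> odd (card N)"
      by (simp add: par_def card_image)
    then show ?thesis unfolding asg_def by (subst par_neq) simp_all
  qed
  show ?thesis
  proof (intro equalityI subsetI)
    fix C assume "C \<in> xor_cnf ?ys"
    then obtain N where N: "C = clause N" "N \<subseteq> {..<?n}" "odd (card N)"
      by (auto simp: xor_cnf_def clause_def)
    show "C \<in> gate (set vs) (par (\<lambda>v. v \<in> Z) (set vs))"
      unfolding N(1) clause[OF N(2)] by (rule gateI) (simp add: par_asg[OF N(2)] N(3))
  next
    fix C assume "C \<in> gate (set vs) (par (\<lambda>v. v \<in> Z) (set vs))"
    then obtain I where I: "C = falsified I (set vs)" "par I (set vs) \<noteq> par (\<lambda>v. v \<in> Z) (set vs)"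
      by (rule gateE)
    define N where "N = {i. i < ?n \<and> I (vs ! i) \<noteq> (vs ! i \<in> Z)}"
    have N: "N \<subseteq> {..<?n}" by (auto simp: N_def)
    have eq: "I v = asg N v" if "v \<in> set vs" for v
    proof -
      obtain i where "i < ?n" "v = vs ! i" using \<open>v \<in> set vs\<close> by (auto simp: in_set_conv_nth)
      then show ?thesis unfolding asg_def using nth_in[OF _ N, of i] by (auto simp: N_def)
    qed
    have "C = clause N" unfolding I(1) clause[OF N] using eq by (rule falsified_cong)
    moreover have "par I (set vs) = par (asg N) (set vs)" using eq by (rule par_cong)
    then have "odd (card N)" using I(2) par_asg[OF N] by (cases "odd (card N)") simp_all
    ultimately show "C \<in> xor_cnf ?ys" using N by (auto simp: xor_cnf_def clause_def)
  qed
qed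

text \<open>The edges of the chain of gates: the Tseitin variables and the two outermost inputs.\<close>
definition chain_edge :: "'v list \<Rightarrow> 'v list \<Rightarrow> nat \<Rightarrow> 'v" where
  "chain_edge \<sigma> ts k =
     (if k = 0 then \<sigma> ! 0 else if k = length \<sigma> - 2 then \<sigma> ! (length \<sigma> - 1) else ts ! (k - 1))"

text \<open>Counting the outermost inputs as edges gives the end gates the shape of the inner ones,
  so one formula covers all \<open>j < length \<sigma> - 2\<close>.\<close>

definition chain_gate :: "'v list \<Rightarrow> 'v list \<Rightarrow> nat \<Rightarrow> 'v set" where
  "chain_gate \<sigma> ts j = {chain_edge \<sigma> ts j, \<sigma> ! (j + 1), chain_edge \<sigma> ts (j + 1)}"

locale encoding =
  fixes \<sigma> ts :: "'v list"
  assumes dist: "distinct (\<sigma> @ ts)" and len: "4 \<le> length \<sigma>" "length ts = length \<sigma> - 3"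
begin

abbreviation "m \<equiv> length \<sigma>"

lemma not_Nil [simp]: "\<sigma> \<noteq> []"
  using len by auto

lemma nth_neq: "p < m \<Longrightarrow> q < m - 3 \<Longrightarrow> \<sigma> ! p \<noteq> ts ! q" "p < m \<Longrightarrow> q < m - 3 \<Longrightarrow> ts ! q \<noteq> \<sigma> ! p"
  using dist len by (auto simp: disjoint_iff) (metis nth_mem)+

lemma nth_eq: "p < m \<Longrightarrow> q < m \<Longrightarrow> \<sigma> ! p = \<sigma> ! q \<longleftrightarrow> p = q"
  "p < m - 3 \<Longrightarrow> q < m - 3 \<Longrightarrow> ts ! p = ts ! q \<longleftrightarrow> p = q"
  using dist len by (auto simp: nth_eq_iff_index_eq)

lemma input_in_chain_gate:
  assumes "j < m - 2" "p < m"
  shows "\<sigma> ! p \<in> chain_gate \<sigma> ts j \<longleftrightarrow> j = (if p = 0 then 0 else if p = m - 1 then m - 3 else p - 1)"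
proof -
  have "\<sigma> ! p = chain_edge \<sigma> ts j \<longleftrightarrow> j = 0 \<and> p = 0"
    using assms len by (auto simp: chain_edge_def nth_eq nth_neq)
  moreover have "\<sigma> ! p = chain_edge \<sigma> ts (j + 1) \<longleftrightarrow> j = m - 3 \<and> p = m - 1"
    using assms len by (auto simp: chain_edge_def nth_eq nth_neq)
  moreover have "\<sigma> ! p = \<sigma> ! (j + 1) \<longleftrightarrow> p = j + 1" using assms by (intro nth_eq) auto
  ultimately have "\<sigma> ! p \<in> chain_gate \<sigma> ts j \<longleftrightarrow>
      j = 0 \<and> p = 0 \<or> p = j + 1 \<or> j = m - 3 \<and> p = m - 1"
    by (simp only: chain_gate_def insert_iff empty_iff simp_thms)
  also have "\<dots> \<longleftrightarrow> j = (if p = 0 then 0 else if p = m - 1 then m - 3 else p - 1)"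
  proof -
    consider "p = 0" | "p = m - 1" "p \<noteq> 0" | "p \<noteq> 0" "p \<noteq> m - 1" by blast
    then show ?thesis
    proof cases
      case 1
      have "0 \<noteq> m - 1" using len by simp
      with 1 show ?thesis by simp
    next
      case 2
      have "m - 1 \<noteq> j + 1" using len assms by linarith
      with 2 show ?thesis by simp
    next
      case 3
      then show ?thesis by auto
    qed
  qed
  finally show ?thesis .
qed

lemma tseitin_in_chain_gate:
  assumes "j < m - 2" "q < m - 3"
  shows "ts ! q \<in> chain_gate \<sigma> ts j \<longleftrightarrow> j \<in> {q, q + 1}"
proof -
  have "ts ! q = chain_edge \<sigma> ts j \<longleftrightarrow> j = q + 1"
    using assms len by (auto simp: chain_edge_def nth_eq nth_neq)
  moreover have "ts ! q = chain_edge \<sigma> ts (j + 1) \<longleftrightarrow> j = q"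
    using assms len by (auto simp: chain_edge_def nth_eq nth_neq)
  moreover have "ts ! q \<noteq> \<sigma> ! (j + 1)" using assms by (intro nth_neq) auto
  ultimately show ?thesis unfolding chain_gate_def by simp blast
qed

lemma chain_gate_subset: "j < m - 2 \<Longrightarrow> chain_gate \<sigma> ts j \<subseteq> set \<sigma> \<union> set ts"
  using len by (auto simp: chain_gate_def chain_edge_def)

lemma card_chain_gates:
  "card {j \<in> {..<m - 2}. v \<in> chain_gate \<sigma> ts j} = (if v \<in> set \<sigma> then 1 else if v \<in> set ts then 2 else 0)"
proof -
  consider "v \<in> set \<sigma>" | "v \<notin> set \<sigma>" "v \<in> set ts" | "v \<notin> set \<sigma>" "v \<notin> set ts" by blast
  then show ?thesis
  proof cases
    case 1
    then obtain p where p: "p < m" "v = \<sigma> ! p" by (auto simp: in_set_conv_nth)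
    have "{j \<in> {..<m - 2}. v \<in> chain_gate \<sigma> ts j} = {if p = 0 then 0 else if p = m - 1 then m - 3 else p - 1}"
      using input_in_chain_gate[OF _ p(1)] p len by auto
    with 1 show ?thesis by simp
  next
    case 2
    then obtain q where q: "q < m - 3" "v = ts ! q" using len by (auto simp: in_set_conv_nth)
    have "{j \<in> {..<m - 2}. v \<in> chain_gate \<sigma> ts j} = {q, q + 1}"
      using tseitin_in_chain_gate[OF _ q(1)] q by auto
    with 2 show ?thesis by simp
  next
    case 3
    then have none: "{j \<in> {..<m - 2}. v \<in> chain_gate \<sigma> ts j} = {}" using chain_gate_subset by auto
    show ?thesis unfolding none using 3 by simp
  qed
qed

text \<open>Tseitin variables enter the encoding unnegated, hence \<open>Z\<close> must avoid them;
  negated inputs show up only in the charges.\<close>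

lemma linear_encoding_eq_net_cnf:
  assumes Z: "Z \<inter> set ts = {}"
  shows "linear_encoding (map (lit_of Z) \<sigma>) ts =
    net_cnf {..<m - 2} (chain_gate \<sigma> ts) (\<lambda>j. par (\<lambda>v. v \<in> Z) (chain_gate \<sigma> ts j))"
proof -
  let ?G = "\<lambda>j. gate (chain_gate \<sigma> ts j) (par (\<lambda>v. v \<in> Z) (chain_gate \<sigma> ts j))"
  have G: "?G j = xor_cnf (map (lit_of Z) [chain_edge \<sigma> ts j, \<sigma> ! (j + 1), chain_edge \<sigma> ts (j + 1)])"
    if j: "j < m - 2" for j
  proof -
    have "distinct [chain_edge \<sigma> ts j, \<sigma> ! (j + 1), chain_edge \<sigma> ts (j + 1)]"
      using j len by (auto simp: chain_edge_def nth_eq nth_neq)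
    from xor_cnf_eq_gate[OF this, of Z] show ?thesis by (simp add: chain_gate_def)
  qed
  have pos: "lit_of Z (ts ! q) = Pos (ts ! q)" if "q < m - 3" for q
    using Z that len by (auto simp: lit_of_def disjoint_iff)
  \<comment> \<open>The first, last and inner gates match the three parts of
    \<open>linear_encoding\<close>, whose inner index starts one lower than the gate index.\<close>
  have "{..<m - 2} = insert 0 (insert (m - 3) (Suc ` {..<m - 4}))"
  proof (intro equalityI subsetI)
    fix j assume "j \<in> {..<m - 2}"
    then show "j \<in> insert 0 (insert (m - 3) (Suc ` {..<m - 4}))"
      using len by (cases j) auto
  qed (use len in auto)
  then have "net_cnf {..<m - 2} (chain_gate \<sigma> ts) (\<lambda>j. par (\<lambda>v. v \<in> Z) (chain_gate \<sigma> ts j)) =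
      ?G 0 \<union> (\<Union>j<m - 4. ?G (Suc j)) \<union> ?G (m - 3)"
    unfolding net_cnf_def by auto
  also have "?G 0 = xor_cnf [map (lit_of Z) \<sigma> ! 0, map (lit_of Z) \<sigma> ! 1, Pos (ts ! 0)]"
  proof -
    have "0 < m - 2" "1 \<noteq> m - 2" "0 < m" "1 < m" "0 < m - 3" using len by auto
    then show ?thesis using G[of 0] pos[of 0] by (simp add: chain_edge_def)
  qed
  also have "?G (m - 3) = xor_cnf [Pos (ts ! (m - 4)), map (lit_of Z) \<sigma> ! (m - 2), map (lit_of Z) \<sigma> ! (m - 1)]"
  proof -
    have "m - 3 < m - 2" "m - 3 + 1 = m - 2" "m - 3 \<noteq> 0" "m - 3 \<noteq> m - 2" "m - 3 - 1 = m - 4"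
      "m - 2 \<noteq> 0" "m - 4 < m - 3" "m - 2 < m" "m - 1 < m" using len by auto
    then show ?thesis using G[of "m - 3"] pos[of "m - 4"] by (simp add: chain_edge_def)
  qed
  also have "(\<Union>j<m - 4. ?G (Suc j)) =
      (\<Union>j<m - 4. xor_cnf [Pos (ts ! j), map (lit_of Z) \<sigma> ! (j + 2), Pos (ts ! (j + 1))])"
  proof (intro SUP_cong refl)
    fix j assume "j \<in> {..<m - 4}"
    then have "Suc j < m - 2" "Suc j \<noteq> m - 2" "Suc (Suc j) \<noteq> m - 2" "j < m - 3" "Suc j < m - 3" "j + 2 < m"
      by auto
    then show "?G (Suc j) = xor_cnf [Pos (ts ! j), map (lit_of Z) \<sigma> ! (j + 2), Pos (ts ! (j + 1))]"
      using G[of "Suc j"] pos[of j] pos[of "Suc j"] by (simp add: chain_edge_def)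
  qed
  finally show ?thesis by (simp add: linear_encoding_def Let_def)
qed

end

section \<open>The three chains as one network, and the final line count\<close>

lemma lit_of_empty: "lit_of {} = Pos"
  by (simp add: lit_of_def fun_eq_iff)

text \<open>The factor 3 stands for three constraints with at most \<open>n\<close> inputs each.
  From \<open>ln 2 \<ge> 1 / 2\<close> and \<open>3 \<le> n\<close> the binary logarithm is at most
  \<open>4 * ln n\<close>; rounding up adds at most \<open>1 \<le> ln n\<close>, which gives
  5.\<close>

lemma log_bound:
  assumes "4 \<le> n"
  shows "\<exists>d. 3 * n < 2 ^ d \<and> real d \<le> 5 * ln (real n) \<and> 1 \<le> ln (real n)"
proof -
  define d where "d = nat \<lfloor>log 2 (real (3 * n))\<rfloor> + 1"
  have n: "4 \<le> real n" using assms by simp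
  have "ln (1 / 2 :: real) \<le> 1 / 2 - 1" by (rule ln_le_minus_one) simp
  then have ln2: "1 / 2 \<le> ln (2 :: real)" by (simp add: ln_div)
  have "ln (4 :: real) = 2 * ln 2" using ln_realpow[of "2 :: real" 2] by simp
  moreover have "ln 4 \<le> ln (real n)" "ln 3 \<le> ln (real n)" using n by simp_all
  ultimately have ln_n: "1 \<le> ln (real n)" "ln 3 \<le> ln (real n)" using ln2 by linarith+
  have log_nonneg: "0 \<le> log 2 (real (3 * n))" using n by (intro zero_le_log_cancel_iff[THEN iffD2]) auto
  then have d: "log 2 (real (3 * n)) < real d" "real d \<le> log 2 (real (3 * n)) + 1"
    unfolding d_def by linarith+
  have "real (3 * n) < 2 powr real d" using d(1) n by (simp add: log_less_iff)
  then have "real (3 * n) < real (2 ^ d)" by (simp add: powr_realpow)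
  then have "3 * n < 2 ^ d" by (simp only: of_nat_less_iff)
  moreover have "real d \<le> 5 * ln (real n)"
  proof -
    have "log 2 (real (3 * n)) = (ln 3 + ln (real n)) / ln 2"
      using n by (simp add: log_def ln_mult)
    also have "\<dots> \<le> (ln (real n) + ln (real n)) / (1 / 2)"
      using ln2 ln_n by (intro frac_le) auto
    also have "\<dots> = 4 * ln (real n)" by simp
    finally show ?thesis using d(2) ln_n by linarith
  qed
  ultimately show ?thesis using ln_n(1) by blast
qed

lemma refutable_triple:
  assumes enc: "encoding \<sigma>a S" "encoding \<sigma>b T" "encoding \<sigma>c U"
    and disj: "distinct (S @ T @ U)" "(set S \<union> set T \<union> set U) \<inter> (set \<sigma>a \<union> set \<sigma>b) = {}"
    and c: "set \<sigma>c = sym_diff (set \<sigma>a) (set \<sigma>b)" "z \<in> set \<sigma>c"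
    and d: "length \<sigma>a + length \<sigma>b + length \<sigma>c < 2 ^ d"
  defines "F \<equiv> Parity \<sigma>a S \<union> Parity \<sigma>b T \<union> linear_encoding (map (lit_of {z}) \<sigma>c) U"
  shows "\<exists>\<pi>. drat_minus_refutation F \<pi> \<and>
    length \<pi> \<le> (length \<sigma>a + length \<sigma>b + length \<sigma>c) * (8192 * d + 2064) + 1"
proof -
  interpret a: encoding \<sigma>a S by (rule enc)
  interpret b: encoding \<sigma>b T by (rule enc)
  interpret c: encoding \<sigma>c U by (rule enc)
  let ?Ja = "{..<length \<sigma>a - 2}" and ?Jb = "{..<length \<sigma>b - 2}" and ?Jc = "{..<length \<sigma>c - 2}"
  define I :: "(nat \<times> nat) set" where "I = {0} \<times> ?Ja \<union> {1} \<times> ?Jb \<union> {2} \<times> ?Jc"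
  define V where "V = (\<lambda>(k :: nat, j). if k = 0 then chain_gate \<sigma>a S j
      else if k = 1 then chain_gate \<sigma>b T j else chain_gate \<sigma>c U j)"
  \<comment> \<open>The only negated literal puts the charge on the gate of the third chain
    containing \<open>z\<close>. As an input of that chain \<open>z\<close> lies in just one of its
    gates, so the total charge is odd.\<close>
  define ch where "ch = (\<lambda>(k, j). k = (2 :: nat) \<and> z \<in> V (k, j))"
  have z: "{z} \<inter> set U = {}" using disj(2) c by auto
  have F: "F = net_cnf I V ch"
  proof -
    have "net_cnf I V ch = net_cnf ?Ja (\<lambda>j. V (0, j)) (\<lambda>j. ch (0, j)) \<union>
        net_cnf ?Jb (\<lambda>j. V (1, j)) (\<lambda>j. ch (1, j)) \<union> net_cnf ?Jc (\<lambda>j. V (2, j)) (\<lambda>j. ch (2, j))"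
      unfolding net_cnf_def I_def by blast
    moreover have "(\<lambda>j. V (0, j)) = chain_gate \<sigma>a S" "(\<lambda>j. V (1, j)) = chain_gate \<sigma>b T"
      "(\<lambda>j. V (2, j)) = chain_gate \<sigma>c U"
      by (simp_all add: V_def)
    moreover have "(\<lambda>j. ch (0, j)) = (\<lambda>j. False)" "(\<lambda>j. ch (1, j)) = (\<lambda>j. False)"
      "(\<lambda>j. ch (2, j)) = (\<lambda>j. z \<in> chain_gate \<sigma>c U j)"
      by (simp_all add: ch_def V_def)
    moreover have "par (\<lambda>v. v \<in> {}) W \<longleftrightarrow> False" "par (\<lambda>v. v \<in> {z}) W \<longleftrightarrow> z \<in> W" for W :: "'a set"
      using par_eq_singleton[of z W] by (simp_all add: par_def)
    ultimately show ?thesis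
      using a.linear_encoding_eq_net_cnf[of "{}"] b.linear_encoding_eq_net_cnf[of "{}"]
        c.linear_encoding_eq_net_cnf[OF z]
      by (simp only: F_def Parity_def lit_of_empty Int_empty_left)
  qed
  have finI: "finite I" by (simp add: I_def)
  have card_I: "card {i \<in> I. P i} = card {j \<in> ?Ja. P (0, j)} + card {j \<in> ?Jb. P (1, j)} + card {j \<in> ?Jc. P (2, j)}" for P
  proof -
    have "{i \<in> I. P i} = {0} \<times> {j \<in> ?Ja. P (0, j)} \<union> {1} \<times> {j \<in> ?Jb. P (1, j)} \<union> {2} \<times> {j \<in> ?Jc. P (2, j)}"
      by (auto simp: I_def)
    then show ?thesis by (simp add: card_Un_disjoint card_cartesian_product disjoint_iff)
  qed
  \<comment> \<open>Disjointness makes this sum 2 for every variable that occurs: a Tseitin variable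
    counts twice in its own chain, and an input of either constraint lies in exactly two of
    \<open>set \<sigma>a\<close>, \<open>set \<sigma>b\<close> and their symmetric
    difference.\<close>
  have occ: "card {i \<in> I. v \<in> V i} =
      (if v \<in> set \<sigma>a then 1 else if v \<in> set S then 2 else 0) +
      (if v \<in> set \<sigma>b then 1 else if v \<in> set T then 2 else 0) +
      (if v \<in> set \<sigma>c then 1 else if v \<in> set U then 2 else 0)" for v
    unfolding card_I
    using a.card_chain_gates[of v] b.card_chain_gates[of v] c.card_chain_gates[of v]
    by (simp add: V_def)
  have V: "finite (V i)" "card (V i) \<le> 3" "V i \<noteq> {}" for i
    by (auto simp: V_def chain_gate_def card_insert_if split: prod.splits)
  have net: "parity_net (vars F) I V ch"
    unfolding parity_net_def
  proof (intro conjI ballI)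
    fix i assume i: "i \<in> I"
    have "gate (V i) (ch i) \<subseteq> F" using i unfolding F net_cnf_def by blast
    then have "vars (gate (V i) (ch i)) \<subseteq> vars F" unfolding vars_def by blast
    then show "V i \<subseteq> vars F" using vars_gate[OF V(1,3)] by metis
    fix v assume v: "v \<in> V i"
    then have "{i \<in> I. v \<in> V i} \<noteq> {}" using i by blast
    then have "card {i \<in> I. v \<in> V i} \<noteq> 0" using finI by simp
    moreover have "v \<in> set S \<Longrightarrow> v \<notin> set T \<and> v \<notin> set U" "v \<in> set T \<Longrightarrow> v \<notin> set U"
      using disj(1) by auto
    moreover have "v \<in> set S \<union> set T \<union> set U \<Longrightarrow> v \<notin> set \<sigma>a \<and> v \<notin> set \<sigma>b"
      using disj(2) by blast
    moreover have "v \<in> set \<sigma>c \<longleftrightarrow> (v \<in> set \<sigma>a) \<noteq> (v \<in> set \<sigma>b)" unfolding c(1) by blast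
    ultimately show "card {i \<in> I. v \<in> V i} = 2"
      unfolding occ
      by (cases "v \<in> set \<sigma>a"; cases "v \<in> set \<sigma>b"; cases "v \<in> set S"; cases "v \<in> set T"; cases "v \<in> set U"; simp)
  next
    have "card {i \<in> I. ch i} = 1"
      unfolding card_I using c.card_chain_gates[of z] c(2) by (simp add: ch_def V_def)
    then show "par ch I" by (simp add: par_def)
  qed (use finI V in auto)
  have "card I = (length \<sigma>a - 2) + (length \<sigma>b - 2) + (length \<sigma>c - 2)"
    using card_I[of "\<lambda>_. True"] by simp
  then have le: "card I \<le> length \<sigma>a + length \<sigma>b + length \<sigma>c" by linarith
  then have "card I < 2 ^ d" using d by linarith
  from parity_net_refutable[OF net this] obtain G where
    G: "reach (vars F) F (card I * (8192 * d + 2064)) G" "{} \<in> G" unfolding F by blast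
  from reach_mono[OF G(1) mult_le_mono1[OF le]]
  have "reach (vars F) F ((length \<sigma>a + length \<sigma>b + length \<sigma>c) * (8192 * d + 2064)) G" .
  from reach_refutation[OF this G(2)] show ?thesis
    by (auto simp: drat_minus_refutation_def)
qed

theorem theorem3:
  "\<exists>f :: nat \<Rightarrow> real. f \<in> O(\<lambda>n. real n * ln (real n)) \<and>
     (\<forall>n (xs :: 'v list) A B \<sigma>a \<sigma>b S T U z.
        length xs = n \<longrightarrow> distinct xs \<longrightarrow>
        A \<subseteq> set xs \<longrightarrow> B \<subseteq> set xs \<longrightarrow>
        \<sigma>a \<in> permutations_of_set A \<longrightarrow> \<sigma>b \<in> permutations_of_set B \<longrightarrow>
        z \<in> sym_diff A B \<longrightarrow>
        card A \<ge> 4 \<longrightarrow> card B \<ge> 4 \<longrightarrow> card (sym_diff A B) \<ge> 4 \<longrightarrow>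
        length S = card A - 3 \<longrightarrow> length T = card B - 3 \<longrightarrow> length U = card (sym_diff A B) - 3 \<longrightarrow>
        distinct (xs @ S @ T @ U) \<longrightarrow>
        (\<exists>\<pi>. drat_minus_refutation (rAddPar xs \<sigma>a S \<sigma>b T z U) \<pi> \<and> real (length \<pi>) \<le> f n))"
proof (intro exI[of _ "\<lambda>n. 130000 * (real n * ln (real n))"] conjI allI impI)
  show "(\<lambda>n. 130000 * (real n * ln (real n))) \<in> O(\<lambda>n. real n * ln (real n))" by simp
next
  fix n :: nat and xs :: "'v list" and A B \<sigma>a \<sigma>b S T U z
  assume n: "length xs = n" "distinct xs" and sub: "A \<subseteq> set xs" "B \<subseteq> set xs"
    and \<sigma>: "\<sigma>a \<in> permutations_of_set A" "\<sigma>b \<in> permutations_of_set B" and z: "z \<in> sym_diff A B"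
    and card: "4 \<le> card A" "4 \<le> card B" "4 \<le> card (sym_diff A B)"
    and len: "length S = card A - 3" "length T = card B - 3" "length U = card (sym_diff A B) - 3"
    and dist: "distinct (xs @ S @ T @ U)"
  define \<sigma>c where "\<sigma>c = filter (\<lambda>v. v \<in> sym_diff A B) xs"
  have set: "set \<sigma>a = A" "set \<sigma>b = B" "set \<sigma>c = sym_diff A B"
    and dist\<sigma>: "distinct \<sigma>a" "distinct \<sigma>b" "distinct \<sigma>c"
    using \<sigma> sub n by (auto simp: permutations_of_set_def \<sigma>c_def)
  have len\<sigma>: "length \<sigma>a = card A" "length \<sigma>b = card B" "length \<sigma>c = card (sym_diff A B)"
    using distinct_card[OF dist\<sigma>(1)] distinct_card[OF dist\<sigma>(2)] distinct_card[OF dist\<sigma>(3)]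
    unfolding set by simp_all
  have card_le: "card A \<le> n" "card B \<le> n" "card (sym_diff A B) \<le> n"
    using card_mono[of "set xs" A] card_mono[of "set xs" B] card_mono[of "set xs" "sym_diff A B"]
      sub n distinct_card[of xs] by auto
  then have n4: "4 \<le> n" using card by simp
  then obtain d where d: "3 * n < 2 ^ d" "real d \<le> 5 * ln (real n)" and ln: "1 \<le> ln (real n)"
    using log_bound by blast
  have "rAddPar xs \<sigma>a S \<sigma>b T z U =
      Parity \<sigma>a S \<union> Parity \<sigma>b T \<union> linear_encoding (map (lit_of {z}) \<sigma>c) U"
  proof -
    have "(\<lambda>v. if v = z then Neg v else Pos v) = lit_of {z}" by (simp add: lit_of_def fun_eq_iff)
    then show ?thesis by (simp add: rAddPar_def sum_constraint_def set(1,2) \<sigma>c_def)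
  qed
  moreover have disj: "set xs \<inter> (set S \<union> set T \<union> set U) = {}" using dist by auto
  have "\<exists>\<pi>. drat_minus_refutation (Parity \<sigma>a S \<union> Parity \<sigma>b T \<union> linear_encoding (map (lit_of {z}) \<sigma>c) U) \<pi> \<and>
    length \<pi> \<le> (length \<sigma>a + length \<sigma>b + length \<sigma>c) * (8192 * d + 2064) + 1"
  proof (rule refutable_triple)
    show "encoding \<sigma>a S" "encoding \<sigma>b T" "encoding \<sigma>c U"
      using dist dist\<sigma> len len\<sigma> card disj sub set by unfold_locales auto
    show "distinct (S @ T @ U)" using dist by simp
    show "(set S \<union> set T \<union> set U) \<inter> (set \<sigma>a \<union> set \<sigma>b) = {}" using disj sub set by blast
    show "set \<sigma>c = sym_diff (set \<sigma>a) (set \<sigma>b)" "z \<in> set \<sigma>c" using set z by auto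
    show "length \<sigma>a + length \<sigma>b + length \<sigma>c < 2 ^ d" using len\<sigma> card_le d(1) by linarith
  qed
  ultimately obtain \<pi> where \<pi>: "drat_minus_refutation (rAddPar xs \<sigma>a S \<sigma>b T z U) \<pi>"
    "length \<pi> \<le> (length \<sigma>a + length \<sigma>b + length \<sigma>c) * (8192 * d + 2064) + 1" by auto
  have "length \<pi> \<le> 3 * n * (8192 * d + 2064) + 1"
  proof -
    have "length \<sigma>a + length \<sigma>b + length \<sigma>c \<le> 3 * n" using len\<sigma> card_le by linarith
    from mult_le_mono1[OF this, of "8192 * d + 2064"] \<pi>(2) show ?thesis by linarith
  qed
  then have "real (length \<pi>) \<le> real (3 * n * (8192 * d + 2064) + 1)" by (simp only: of_nat_le_iff)
  also have "\<dots> = 3 * real n * (8192 * real d + 2064) + 1" by simp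
  \<comment> \<open>With \<open>1 \<le> ln n\<close> the additive terms are absorbed, leaving the
    factor \<open>3 * (8192 * 5 + 2064) + 1 = 129073\<close>, rounded up.\<close>
  also have "\<dots> \<le> 130000 * (real n * ln (real n))"
  proof -
    have "3 * real n * (8192 * real d + 2064) + 1 \<le> 3 * real n * (8192 * (5 * ln (real n)) + 2064 * ln (real n)) + real n * ln (real n)"
    proof (intro add_mono mult_left_mono)
      show "1 \<le> real n * ln (real n)" using mult_mono[of 1 "real n" 1 "ln (real n)"] ln n4 by simp
    qed (use d(2) ln in auto)
    also have "\<dots> \<le> 130000 * (real n * ln (real n))" using ln by (simp add: algebra_simps)
    finally show ?thesis .
  qed
  finally show "\<exists>\<pi>. drat_minus_refutation (rAddPar xs \<sigma>a S \<sigma>b T z U) \<pi> \<and>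
      real (length \<pi>) \<le> 130000 * (real n * ln (real n))"
    using \<pi>(1) by blast
qed

end
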